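(* Let $G$ be a separated single-crossing topological multigraph (without loops) on $n$ vertices. Then the number of edges of $G$ satisfies $|E(G)| \leq 64 n^{2}\log n$, where $\log$ denotes the logarithm to base $2$.
   Context: A topological (multi)graph is a (multi)graph drawn in the plane so that vertices are distinct points and edges are simple continuous arcs joining the corresponding endpoints; an edge does not pass through any vertex other than its endpoints, and whenever two edges share an interior point they properly cross there. A multigraph may have several edges joining the same pair of vertices; such edges are called parallel. The drawing is single-crossing if any two edges have at most one common interior point (crossing); this applies also to edges sharing an endpoint. The multigraph is separated if no two parallel edges cross, and for any two parallel edges the bounded region ("lens") enclosed by them contains at least one vertex in its interior. *)

theory Defs
  imports "HOL-Analysis.Analysis"
begin

text \<open>The plane is the complex plane. An edge is drawn as an arc
  (a continuous injective path g on [0,1]); its endpoints are pathstart g and pathfinish g.\<close>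

definition edge_interior :: "(real \<Rightarrow> complex) \<Rightarrow> complex set" where
  "edge_interior g = g ` {0<..<1}"

definition proper_crossing :: "(real \<Rightarrow> complex) \<Rightarrow> (real \<Rightarrow> complex) \<Rightarrow> complex \<Rightarrow> bool" where
  "proper_crossing g1 g2 p \<longleftrightarrow>
     (\<exists>U h k. open U \<and> p \<in> U \<and> homeomorphism U (ball 0 1) h k \<and> h p = 0 \<and>
        h ` (U \<inter> path_image g1) = {z \<in> ball 0 1. Im z = 0} \<and>
        h ` (U \<inter> path_image g2) = {z \<in> ball 0 1. Re z = 0})"

text \<open>Topological multigraph with vertex set V, edge index set E and drawing \<gamma>.
  Injectivity of arcs excludes loops.\<close>
definition topological_multigraph ::
  "complex set \<Rightarrow> 'e set \<Rightarrow> ('e \<Rightarrow> real \<Rightarrow> complex) \<Rightarrow> bool" where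
  "topological_multigraph V E \<gamma> \<longleftrightarrow>
     finite V \<and> finite E \<and>
     (\<forall>e\<in>E. arc (\<gamma> e) \<and> pathstart (\<gamma> e) \<in> V \<and> pathfinish (\<gamma> e) \<in> V \<and>
        path_image (\<gamma> e) \<inter> V = {pathstart (\<gamma> e), pathfinish (\<gamma> e)}) \<and>
     (\<forall>e\<in>E. \<forall>e'\<in>E. e \<noteq> e' \<longrightarrow>
        (\<forall>p \<in> edge_interior (\<gamma> e) \<inter> edge_interior (\<gamma> e'). proper_crossing (\<gamma> e) (\<gamma> e') p))"

definition parallel_edges :: "('e \<Rightarrow> real \<Rightarrow> complex) \<Rightarrow> 'e \<Rightarrow> 'e \<Rightarrow> bool" where
  "parallel_edges \<gamma> e e' \<longleftrightarrow>
     {pathstart (\<gamma> e), pathfinish (\<gamma> e)} = {pathstart (\<gamma> e'), pathfinish (\<gamma> e')}"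

definition single_crossing :: "'e set \<Rightarrow> ('e \<Rightarrow> real \<Rightarrow> complex) \<Rightarrow> bool" where
  "single_crossing E \<gamma> \<longleftrightarrow>
     (\<forall>e\<in>E. \<forall>e'\<in>E. e \<noteq> e' \<longrightarrow>
        (\<forall>p q. p \<in> edge_interior (\<gamma> e) \<inter> edge_interior (\<gamma> e') \<longrightarrow>
               q \<in> edge_interior (\<gamma> e) \<inter> edge_interior (\<gamma> e') \<longrightarrow> p = q))"

text \<open>Separated: parallel edges do not cross, and the lens (bounded region enclosed by
  the two arcs, i.e. the inside of their union) contains a vertex.\<close>
definition separated :: "complex set \<Rightarrow> 'e set \<Rightarrow> ('e \<Rightarrow> real \<Rightarrow> complex) \<Rightarrow> bool" where
  "separated V E \<gamma> \<longleftrightarrow>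
     (\<forall>e\<in>E. \<forall>e'\<in>E. e \<noteq> e' \<and> parallel_edges \<gamma> e e' \<longrightarrow>
        edge_interior (\<gamma> e) \<inter> edge_interior (\<gamma> e') = {} \<and>
        (\<exists>v\<in>V. v \<in> inside (path_image (\<gamma> e) \<union> path_image (\<gamma> e'))))"

end

theory Submission
  imports Defs "HOL-Complex_Analysis.Complex_Analysis"
begin

text \<open>Induction on the number of vertices: delete a vertex \<open>x\<close> of minimum degree. A pair of
  parallel edges violates separation afterwards only if its lens contains \<open>x\<close> and no other vertex;
  each pair of vertices spans at most one such thin lens, so deleting one edge per thin lens
  restores separation. It remains to see that the graph \<open>H\<close> of end pairs of thin lenses around
  \<open>x\<close> has linearly many edges; then \<open>(n - 2) / n * |E(n)| \<le> |E(n-1)| + 8 n\<close>, which gives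
  \<open>n\<^sup>2 log n\<close>.

  Two thin lenses around \<open>x\<close> with disjoint ends traverse each other, hence one side of the first
  and one side of the second have algebraic intersection number \<open>1\<close> or \<open>-1\<close>. Expressing this
  number by winding numbers around the end points yields a parity identity for every pair of
  disjoint edges of \<open>H\<close>. On a bipartite subgraph this identity can be normalized to the one
  satisfied by a plane drawing. The normalized identity survives deletions and contractions of
  edges and fails for the complete graph on five vertices, so Mader's argument bounds the number of
  edges.\<close>

section \<open>Graphs with a mod-2 plane drawing\<close>

definition edge_contract :: "'v \<Rightarrow> 'v \<Rightarrow> 'v set set \<Rightarrow> 'v set set" where
  "edge_contract u v E = (\<lambda>e. if v \<in> e then insert u (e - {v}) else e) ` (E - {{u, v}})"

definition minor_closed :: "('v set set \<Rightarrow> bool) \<Rightarrow> bool" where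
  "minor_closed P \<longleftrightarrow>
     (\<forall>E F. P E \<longrightarrow> F \<subseteq> E \<longrightarrow> P F) \<and>
     (\<forall>E u v. P E \<longrightarrow> {u, v} \<in> E \<longrightarrow> u \<noteq> v \<longrightarrow> P (edge_contract u v E))"

text \<open>Graphs are bare edge sets, so the apex is joined only to vertices covered by
  \<open>E\<close>. Each application takes one vertex off an excluded complete graph: three of them
  turn the exclusion of K_5 into that of K_2.\<close>

definition cone_class :: "('v set set \<Rightarrow> bool) \<Rightarrow> 'v set set \<Rightarrow> bool" where
  "cone_class P E \<longleftrightarrow> (\<exists>z. z \<notin> \<Union>E \<and> P (E \<union> (\<lambda>w. {z, w}) ` \<Union>E))"

lemma edge_contract_Union_subset: "\<Union>(edge_contract u v E) \<subseteq> insert u (\<Union>E - {v})" if "u \<noteq> v"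
  using that by (auto simp: edge_contract_def split: if_splits)

lemma edge_contract_card2:
  assumes "\<forall>e\<in>E. card e = 2" "u \<noteq> v"
  shows "\<forall>e\<in>edge_contract u v E. card e = 2"
proof
  fix e' assume "e' \<in> edge_contract u v E"
  then obtain e where e: "e \<in> E" "e \<noteq> {u, v}" "e' = (if v \<in> e then insert u (e - {v}) else e)"
    unfolding edge_contract_def by blast
  obtain a b where ab: "e = {a, b}" "a \<noteq> b"
    using assms(1) e(1) by (meson card_2_iff)
  then show "card e' = 2"
    using e assms(2) by (auto simp: insert_commute card_insert_if)
qed

text \<open>Contracting uv in the cone over \<open>E\<close> leaves the apex alone and merges only
  the spokes to u and v. The result therefore contains the cone over the contracted graph with the
  same apex.\<close>

lemma minor_closed_cone_class:
  assumes "minor_closed P"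
  shows "minor_closed (cone_class P)"
  unfolding minor_closed_def
proof (intro conjI allI impI)
  fix E F :: "'a set set"
  assume "cone_class P E" "F \<subseteq> E"
  then obtain z where z: "z \<notin> \<Union>E" "P (E \<union> (\<lambda>w. {z, w}) ` \<Union>E)"
    by (auto simp: cone_class_def)
  have "F \<union> (\<lambda>w. {z, w}) ` \<Union>F \<subseteq> E \<union> (\<lambda>w. {z, w}) ` \<Union>E"
    using \<open>F \<subseteq> E\<close> by blast
  then have "P (F \<union> (\<lambda>w. {z, w}) ` \<Union>F)"
    using assms z(2) unfolding minor_closed_def by metis
  moreover have "z \<notin> \<Union>F" using z(1) \<open>F \<subseteq> E\<close> by blast
  ultimately show "cone_class P F"
    unfolding cone_class_def by blast
next
  fix E :: "'a set set" and u v
  assume "cone_class P E" and uv: "{u, v} \<in> E" "u \<noteq> v"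
  then obtain z where z: "z \<notin> \<Union>E" "P (E \<union> (\<lambda>w. {z, w}) ` \<Union>E)"
    by (auto simp: cone_class_def)
  let ?C = "E \<union> (\<lambda>w. {z, w}) ` \<Union>E"
  let ?F = "edge_contract u v E"
  have zn: "z \<noteq> u" "z \<noteq> v" using z(1) uv(1) by auto
  have P: "P (edge_contract u v ?C)"
    using assms z(2) uv unfolding minor_closed_def by blast
  have F: "?F \<subseteq> edge_contract u v ?C"
    by (auto simp: edge_contract_def)
  have spoke: "{z, w} \<in> edge_contract u v ?C" if w: "w \<in> \<Union>?F" for w
  proof -
    have w': "w = u \<or> w \<in> \<Union>E" "w \<noteq> v"
      using w uv(2) edge_contract_Union_subset[of u v E] by auto
    then have "w \<in> \<Union>E" using uv(1) by blast
    then have "{z, w} \<in> ?C - {{u, v}}"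
      using zn by (auto simp: doubleton_eq_iff)
    moreover have "(if v \<in> {z, w} then insert u ({z, w} - {v}) else {z, w}) = {z, w}"
      using zn w'(2) by auto
    ultimately show ?thesis
      unfolding edge_contract_def by (intro image_eqI[where x = "{z, w}"]) auto
  qed
  have "P (?F \<union> (\<lambda>w. {z, w}) ` \<Union>?F)"
    using P F spoke assms unfolding minor_closed_def
    by (metis (no_types, lifting) Un_least image_subsetI)
  moreover have "z \<notin> \<Union>?F"
    using edge_contract_Union_subset[OF uv(2), of E] zn z(1) by blast
  ultimately show "cone_class P ?F"
    unfolding cone_class_def by blast
qed

text \<open>Apart from uv, contraction identifies two edges only if they are uw and vw for a common
  neighbour w. Hence the loss is uv itself and at most one edge per triangle on uv.\<close>

lemma card_le_edge_contract:
  assumes "finite E" "\<forall>e\<in>E. card e = 2" "{u, v} \<in> E" "u \<noteq> v"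
  shows "card E \<le> card (edge_contract u v E) + card {w. {u, w} \<in> E \<and> {v, w} \<in> E} + 1"
proof -
  let ?f = "\<lambda>e. if v \<in> e then insert u (e - {v}) else e"
  let ?W = "{w. {u, w} \<in> E \<and> {v, w} \<in> E}"
  let ?D = "(\<lambda>w. {v, w}) ` ?W"
  let ?E' = "E - {{u, v}} - ?D"
  have finD: "finite ?D"
    by (rule finite_subset[OF _ assms(1)]) auto
  have inj: "inj_on (\<lambda>w. {v, w}) ?W"
    by (auto simp: inj_on_def doubleton_eq_iff)
  have finW: "finite ?W"
    using finD inj finite_imageD by blast
  have "inj_on ?f ?E'"
  proof (rule inj_onI)
    fix e e' assume e: "e \<in> ?E'" and e': "e' \<in> ?E'" and eq: "?f e = ?f e'"
    have pair: "\<exists>w. x = {v, w} \<and> v \<noteq> w" if "x \<in> E" "v \<in> x" for x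
      using assms(2) that by (metis card_2_iff doubleton_eq_iff insert_iff singletonD)
    have *: "x = y" if x: "x \<in> ?E'" "v \<in> x" and y: "y \<in> ?E'" "v \<notin> y" "?f x = ?f y" for x y
    proof -
      obtain w where w: "x = {v, w}" "v \<noteq> w"
        using x pair by blast
      then have "y = {u, w}" using y(2,3) x by auto
      then have "w \<in> ?W" using x(1) y(1) w by auto
      then show ?thesis using x(1) w by blast
    qed
    show "e = e'"
    proof (cases "v \<in> e"; cases "v \<in> e'")
      assume v: "v \<in> e" "v \<in> e'"
      obtain w where w: "e = {v, w}" "v \<noteq> w"
        using v(1) e pair by blast
      obtain w' where w': "e' = {v, w'}" "v \<noteq> w'"
        using v(2) e' pair by blast
      have "w \<noteq> u" "w' \<noteq> u" using w w' e e' by (auto simp: insert_commute)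
      then show ?thesis using eq v w w' by (auto simp: doubleton_eq_iff)
    next
      assume "v \<notin> e" "v \<notin> e'"
      then show ?thesis using eq by simp
    next
      assume "v \<in> e" "v \<notin> e'"
      then show ?thesis using *[OF e _ e' _ eq] by blast
    next
      assume "v \<notin> e" "v \<in> e'"
      then show ?thesis using *[OF e' _ e _ eq[symmetric]] by blast
    qed
  qed
  then have "card ?E' \<le> card (edge_contract u v E)"
    unfolding edge_contract_def
    by (intro card_inj_on_le[where f = ?f]) (use assms(1) in auto)
  moreover have "card E \<le> card ?E' + card ?D + 1"
  proof -
    have "card E = card (E - {{u, v}}) + 1"
      using assms(1,3) card_Suc_Diff1 by fastforce
    also have "card (E - {{u, v}}) \<le> card ?E' + card ?D"
      using diff_card_le_card_Diff[OF finD, of "E - {{u, v}}"] by linarith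
    finally show ?thesis by simp
  qed
  moreover have "card ?D \<le> card ?W" using finW by (rule card_image_le)
  ultimately show ?thesis by linarith
qed

text \<open>Double counting of incidences. The end map is abstract because the identity serves
  simple graphs, where an edge is its own end set, as well as index sets of multigraph
  edges.\<close>

lemma sum_degrees:
  assumes "finite V" "finite E" "\<forall>e\<in>E. ends e \<subseteq> V \<and> card (ends e) = 2"
  shows "(\<Sum>v\<in>V. card {e\<in>E. v \<in> ends e}) = 2 * card E"
proof -
  have "(\<Sum>v\<in>V. card {e\<in>E. v \<in> ends e}) = (\<Sum>v\<in>V. \<Sum>e\<in>E. if v \<in> ends e then 1 else 0)"
    using assms by (intro sum.cong refl) (simp add: sum.If_cases Int_def)
  also have "\<dots> = (\<Sum>e\<in>E. \<Sum>v\<in>V. if v \<in> ends e then 1 else 0)"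
    by (rule sum.swap)
  also have "\<dots> = (\<Sum>e\<in>E. card (ends e))"
    using assms by (intro sum.cong refl) (simp add: sum.If_cases Int_absorb1)
  also have "\<dots> = 2 * card E" using assms by simp
  finally show ?thesis .
qed

text \<open>Mader's argument: if no edge lies in few triangles, the neighbourhood of any vertex
  is dense and, together with that vertex, contains a cone.\<close>
lemma minor_closed_edge_bound:
  fixes P :: "'v set set \<Rightarrow> bool"
  assumes closed: "minor_closed P"
    and cone: "\<And>V E. \<lbrakk>finite V; V \<noteq> {}; \<forall>e\<in>E. e \<subseteq> V \<and> card e = 2; cone_class P E\<rbrakk>
                 \<Longrightarrow> 2 * card E < k * card V"
    and "finite V" "V \<noteq> {}" "\<forall>e\<in>E. e \<subseteq> V \<and> card e = 2" "P E" "k > 0"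
  shows "card E < k * card V"
  using assms(3-6)
proof (induction "card V" arbitrary: V E rule: less_induct)
  case less
  note V = less.prems(1,2) and E = less.prems(3) and PE = less.prems(4)
  have finE: "finite E"
    using E V(1) by (meson Pow_iff finite_Pow_iff finite_subset subsetI)
  define W where "W u v = {w. {u, w} \<in> E \<and> {v, w} \<in> E}" for u v
  show ?case
  proof (cases "\<exists>u v. {u, v} \<in> E \<and> u \<noteq> v \<and> card (W u v) < k")
    case True
    then obtain u v where uv: "{u, v} \<in> E" "u \<noteq> v" and few: "card (W u v) < k" by blast
    let ?F = "edge_contract u v E"
    have uV: "u \<in> V" "v \<in> V" using uv(1) E by auto
    have "card ?F < k * card (V - {v})"
    proof (rule less.hyps)
      show "card (V - {v}) < card V" using uV V(1) by (meson card_Diff1_less)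
      show "V - {v} \<noteq> {}" using uV uv(2) by blast
      have "\<Union>?F \<subseteq> V - {v}"
        using edge_contract_Union_subset[OF uv(2), of E] E uV uv(2) by blast
      then show "\<forall>e\<in>?F. e \<subseteq> V - {v} \<and> card e = 2"
        using edge_contract_card2[OF _ uv(2), of E] E by blast
      show "P ?F" using closed PE uv unfolding minor_closed_def by blast
    qed (use V in auto)
    moreover have "card E \<le> card ?F + card (W u v) + 1"
      unfolding W_def using card_le_edge_contract[OF finE _ uv] E by blast
    moreover have "card V = Suc (card (V - {v}))"
      using uV(2) V(1) by (metis card_Suc_Diff1)
    \<comment> \<open>The contraction loses one vertex and at most \<open>k\<close> edges, as fewer
      than \<open>k\<close> triangles lie on uv.\<close>
    ultimately show ?thesis using few by simp
  next
    case False
    then have many: "k \<le> card (W u v)" if "{u, v} \<in> E" "u \<noteq> v" for u v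
      using that by force
    show ?thesis
    proof (cases "E = {}")
      case True
      then show ?thesis using V \<open>k > 0\<close> by (simp add: card_gt_0_iff)
    next
      case False
      then obtain z y where zy: "{z, y} \<in> E" "z \<noteq> y"
        using E by (metis all_not_in_conv card_2_iff)
      define N where "N = {w. {z, w} \<in> E}"
      define F where "F = {e\<in>E. e \<subseteq> N}"
      have zN: "z \<notin> N" using E by (auto simp: N_def)
      have NV: "N \<subseteq> V" using E by (auto simp: N_def)
      then have finN: "finite N" using V(1) finite_subset by blast
      have F: "\<forall>e\<in>F. e \<subseteq> N \<and> card e = 2" and finF: "finite F"
        using E finE by (auto simp: F_def)
      have "F \<union> (\<lambda>w. {z, w}) ` \<Union>F \<subseteq> E"
        by (auto simp: F_def N_def)
      then have "P (F \<union> (\<lambda>w. {z, w}) ` \<Union>F)"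
        using closed PE unfolding minor_closed_def by blast
      then have "cone_class P F"
        unfolding cone_class_def using F zN by blast
      then have "2 * card F < k * card N"
        using cone[of N F] finN zy F by (auto simp: N_def)
      \<comment> \<open>Common neighbours of \<open>z\<close> and \<open>w\<close> lie in
        \<open>N\<close>, so every degree inside \<open>N\<close> is at least \<open>k\<close>. The
        degree sum then contradicts the bound for cones.\<close>
      moreover have "k * card N \<le> (\<Sum>w\<in>N. card {e\<in>F. w \<in> e})"
      proof -
        have "k \<le> card {e\<in>F. w \<in> e}" if w: "w \<in> N" for w
        proof -
          have "(\<lambda>t. {w, t}) ` W z w \<subseteq> {e\<in>F. w \<in> e}"
            using w by (auto simp: W_def F_def N_def)
          moreover have "inj_on (\<lambda>t. {w, t}) (W z w)"
            by (auto simp: inj_on_def doubleton_eq_iff)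
          ultimately have "card (W z w) \<le> card {e\<in>F. w \<in> e}"
            using finF by (intro card_inj_on_le[where f = "\<lambda>t. {w, t}"]) auto
          moreover have "k \<le> card (W z w)"
            using many[of z w] w zN unfolding N_def by blast
          ultimately show ?thesis by linarith
        qed
        then show ?thesis
          using sum_bounded_below[of N k "\<lambda>w. card {e\<in>F. w \<in> e}"] by (simp add: mult.commute)
      qed
      ultimately show ?thesis
        using sum_degrees[OF finN finF, of "\<lambda>e. e"] F by auto
    qed
  qed
qed

section \<open>The parity identity and its failure on K_5\<close>

text \<open>A mod-2 shadow of a plane drawing: \<open>s\<close> and \<open>N\<close> give the parity of the number of
  crossings of two vertex-disjoint edges.\<close>
definition crossing_parity ::
  "('v \<Rightarrow> 'v \<Rightarrow> int) \<Rightarrow> ('v set \<Rightarrow> 'v \<Rightarrow> int) \<Rightarrow> 'v set \<Rightarrow> 'v set \<Rightarrow> int" where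
  "crossing_parity s N A B = (\<Sum>p\<in>A. \<Sum>q\<in>B. s p q) + (\<Sum>q\<in>B. N A q) + (\<Sum>p\<in>A. N B p)"

text \<open>Disjoint arcs have intersection number 0, so a plane drawing of a simple graph satisfies
  this with \<open>turn_sign\<close> for \<open>s\<close> and the \<open>excess_turns\<close> of its
  arcs for \<open>N\<close>. Keeping only the oddness of \<open>s p q + s q p\<close> and an
  arbitrary \<open>N\<close> makes closure under contraction a matter of parity arithmetic, without
  redrawing.\<close>

definition mod2_planar :: "'v set set \<Rightarrow> bool" where
  "mod2_planar E \<longleftrightarrow>
     (\<forall>e\<in>E. card e = 2) \<and>
     (\<exists>s N. (\<forall>p q. p \<noteq> q \<longrightarrow> odd (s p q + s q p)) \<and>
            (\<forall>A\<in>E. \<forall>B\<in>E. A \<inter> B = {} \<longrightarrow> even (crossing_parity s N A B)))"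

lemma crossing_parity_pairs:
  assumes "a \<noteq> b" "c \<noteq> d"
  shows "crossing_parity s N {a, b} {c, d} =
    s a c + s a d + s b c + s b d + N {a, b} c + N {a, b} d + N {c, d} a + N {c, d} b"
  using assms by (simp add: crossing_parity_def)

text \<open>Exchanging \<open>A\<close> and \<open>B\<close> reverses the arguments of
  \<open>s\<close> for four pairs of distinct vertices. Each reversal flips the parity, and four
  flips cancel.\<close>

lemma crossing_parity_sym:
  assumes s: "\<And>p q. p \<noteq> q \<Longrightarrow> odd (s p q + s q p)" and "card A = 2" "card B = 2" "A \<inter> B = {}"
  shows "even (crossing_parity s N A B) \<longleftrightarrow> even (crossing_parity s N B A)"
proof -
  obtain a b where A: "A = {a, b}" "a \<noteq> b" using assms(2) by (meson card_2_iff)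
  obtain c d where B: "B = {c, d}" "c \<noteq> d" using assms(3) by (meson card_2_iff)
  have "a \<noteq> c" "a \<noteq> d" "b \<noteq> c" "b \<noteq> d" using assms(4) A B by auto
  then have "odd (s a c + s c a)" "odd (s a d + s d a)" "odd (s b c + s c b)" "odd (s b d + s d b)"
    using s[of a c] s[of a d] s[of b c] s[of b d] by blast+
  then have "even ((s a c + s c a) + (s a d + s d a) + ((s b c + s c b) + (s b d + s d b)))"
    by (simp only: even_add odd_add)
  moreover have "crossing_parity s N A B + crossing_parity s N B A =
      (s a c + s c a) + (s a d + s d a) + ((s b c + s c b) + (s b d + s d b))
      + 2 * (N A c + N A d + N B a + N B b)"
    unfolding A(1) B(1) crossing_parity_pairs[OF A(2) B(2)] crossing_parity_pairs[OF B(2) A(2)]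
    by simp
  ultimately have "even (crossing_parity s N A B + crossing_parity s N B A)" by simp
  then show ?thesis by simp
qed

text \<open>Only \<open>N\<close> changes. The parity of an edge with the path u v w is the sum of
  its parities with uv and vw, as the contributions at v occur twice. Two new edges share u, so the
  condition never compares them.\<close>

lemma minor_closed_mod2_planar: "minor_closed mod2_planar"
  unfolding minor_closed_def
proof (intro conjI allI impI)
  fix E F :: "'a set set"
  assume "mod2_planar E" "F \<subseteq> E"
  then show "mod2_planar F"
    unfolding mod2_planar_def by (meson subsetD)
next
  fix E :: "'a set set" and u v
  assume E: "mod2_planar E" and uv: "{u, v} \<in> E" "u \<noteq> v"
  let ?F = "edge_contract u v E"
  obtain s N where s: "\<And>p q. p \<noteq> q \<Longrightarrow> odd (s p q + s q p)"
    and ev: "\<And>A B. \<lbrakk>A \<in> E; B \<in> E; A \<inter> B = {}\<rbrakk> \<Longrightarrow> even (crossing_parity s N A B)"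
    using E unfolding mod2_planar_def by metis
  have card2: "\<forall>e\<in>E. card e = 2" using E by (simp add: mod2_planar_def)
  have card2F: "\<forall>e\<in>?F. card e = 2" by (rule edge_contract_card2[OF card2 uv(2)])
  text \<open>A new edge \<open>uw\<close> is drawn along the old path \<open>u v w\<close>.\<close>
  define M where "M B = (if B \<in> E then N B else (\<lambda>z. N {u, v} z + N (insert v (B - {u})) z))" for B
  have new: "\<exists>w. B = {u, w} \<and> {v, w} \<in> E \<and> w \<noteq> u \<and> w \<noteq> v" if B: "B \<in> ?F" "B \<notin> E" for B
  proof -
    obtain e where e: "e \<in> E" "e \<noteq> {u, v}" "B = (if v \<in> e then insert u (e - {v}) else e)"
      using B(1) unfolding edge_contract_def by blast
    then have v: "v \<in> e" using B(2) by auto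
    then obtain w where "e = {v, w}" "w \<noteq> v"
      using card2 e(1) by (metis card_2_iff doubleton_eq_iff insert_iff singletonD)
    then show ?thesis using e v by auto
  qed
  have vnot: "v \<notin> A" if "A \<in> ?F" for A
    using that uv(2) by (auto simp: edge_contract_def split: if_splits)
  have mixed: "even (crossing_parity s M A B)"
    if A: "A \<in> ?F" "A \<in> E" and B: "B \<in> ?F" "B \<notin> E" and disj: "A \<inter> B = {}" for A B
  proof -
    obtain w where w: "B = {u, w}" "{v, w} \<in> E" "w \<noteq> u" "w \<noteq> v" using new[OF B] by blast
    obtain a b where ab: "A = {a, b}" "a \<noteq> b" using card2 A(2) by (meson card_2_iff)
    have "insert v (B - {u}) = {v, w}" using w by auto
    then have M: "M B z = N {u, v} z + N {v, w} z" "M A = N A" for z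
      using A B by (auto simp: M_def)
    have "A \<inter> {u, v} = {}" "A \<inter> {v, w} = {}" using disj w vnot[OF A(1)] by auto
    then have "even (crossing_parity s N A {u, v})" "even (crossing_parity s N A {v, w})"
      using ev A(2) uv(1) w(2) by auto
    moreover have "crossing_parity s M A B = crossing_parity s N A {u, v} + crossing_parity s N A {v, w}
        - 2 * (s a v + s b v + N A v)"
      using crossing_parity_pairs[OF ab(2) uv(2), of s N] crossing_parity_pairs[OF ab(2) w(4)[symmetric], of s N]
        crossing_parity_pairs[OF ab(2) w(3)[symmetric], of s M]
      unfolding w(1)[symmetric] ab(1)[symmetric] M by simp
    ultimately show ?thesis by simp
  qed
  have "even (crossing_parity s M A B)" if AB: "A \<in> ?F" "B \<in> ?F" "A \<inter> B = {}" for A B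
  proof -
    consider "A \<in> E" "B \<in> E" | "A \<in> E" "B \<notin> E" | "A \<notin> E" "B \<in> E" | "A \<notin> E" "B \<notin> E" by blast
    then show ?thesis
    proof cases
      case 1
      then have "crossing_parity s M A B = crossing_parity s N A B"
        by (simp add: crossing_parity_def M_def)
      then show ?thesis using ev 1 AB(3) by simp
    next
      case 2
      then show ?thesis using mixed AB by blast
    next
      case 3
      then have "even (crossing_parity s M B A)" using mixed AB by blast
      moreover have "even (crossing_parity s M A B) \<longleftrightarrow> even (crossing_parity s M B A)"
        by (rule crossing_parity_sym[OF s]) (use card2F AB in blast)+
      ultimately show ?thesis by blast
    next
      case 4
      then show ?thesis using new[of A] new[of B] AB by auto
    qed
  qed
  then show "mod2_planar ?F"
    unfolding mod2_planar_def using card2F s by blast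
qed

text \<open>The identity is summed over the 15 pairs of disjoint edges of K_5. Every
  \<open>N {p, q} r\<close> occurs twice, since r lies on two edges that avoid p and q, and every
  two vertices are compared six times. The leftover is odd, which is the parity form of the fact
  that disjoint edges cross an odd number of times in total in any drawing of K_5.\<close>

lemma not_mod2_planar_K5:
  assumes "distinct [a, b, c, d, e]"
    and "mod2_planar E"
    and "{{a,b},{a,c},{a,d},{a,e},{b,c},{b,d},{b,e},{c,d},{c,e},{d,e}} \<subseteq> E"
  shows False
proof -
  obtain s N where s: "\<And>p q. p \<noteq> q \<Longrightarrow> odd (s p q + s q p)"
    and ev: "\<And>A B. \<lbrakk>A \<in> E; B \<in> E; A \<inter> B = {}\<rbrakk> \<Longrightarrow> even (crossing_parity s N A B)"
    using assms(2) unfolding mod2_planar_def by metis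
  have ne: "a \<noteq> b" "a \<noteq> c" "a \<noteq> d" "a \<noteq> e" "b \<noteq> c" "b \<noteq> d" "b \<noteq> e" "c \<noteq> d" "c \<noteq> e" "d \<noteq> e"
    using assms(1) by auto
  have in_E: "{a,b} \<in> E" "{a,c} \<in> E" "{a,d} \<in> E" "{a,e} \<in> E" "{b,c} \<in> E" "{b,d} \<in> E" "{b,e} \<in> E"
    "{c,d} \<in> E" "{c,e} \<in> E" "{d,e} \<in> E" using assms(3) by auto
  define X where "X p q t r = crossing_parity s N {p, q} {t, r}" for p q t r
  have X: "even (X p q t r)" if "{p,q} \<in> E" "{t,r} \<in> E" "distinct [p,q,t,r]" for p q t r
    using ev[of "{p,q}" "{t,r}"] that by (auto simp: X_def)
  have Xe: "X p q t r = s p t + s p r + s q t + s q r + N {p,q} t + N {p,q} r + N {t,r} p + N {t,r} q"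
    if "distinct [p,q,t,r]" for p q t r
    using that crossing_parity_pairs[of p q t r s N] by (simp add: X_def)
  \<comment> \<open>Halving the even number \<open>s p q + s q p - 1\<close> gives a linear rule
    that replaces \<open>s q p\<close> by \<open>s p q\<close>, so all comparisons of two vertices
    can be collected in one order.\<close>
  define t where "t p q = (s p q + s q p - 1) div 2" for p q
  have t: "s q p = 2 * t p q + 1 - s p q" if "p \<noteq> q" for p q
    using s[OF that] unfolding t_def by (auto elim: oddE)
  let ?S = "X a b c d + X a c b d + X a d b c + X a b c e + X a c b e + X a e b c + X a b d e + X a
      d b e + X a e b d + X a c d e + X a d c e + X a e c d + X b c d e + X b d c e + X b e c
      d"
  have "even ?S"
    using ne in_E by (intro dvd_add X) auto
  \<comment> \<open>In the order chosen, the comparison of b with each of c, d, e occurs reversed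
    twice, and that of any two of c, d, e three times. Each reversal leaves a 1, in total 6 + 9 =
    15.\<close>
  moreover have "?S = 2 * (3 * s a b + 3 * s a c + 3 * s a d + 3 * s a e + s b c + 2 * t b c + s b d + 2 * t b d +
      s b e + 2 * t b e + 3 * t c d + 3 * t c e + 3 * t d e + N {a,b} c + N {a,b} d + N {c,d}
      a + N {c,d} b + N {a,c} b + N {a,c} d + N {b,d} a + N {b,d} c + N {a,d} b + N {a,d} c +
      N {b,c} a + N {b,c} d + N {a,b} e + N {c,e} a + N {c,e} b + N {a,c} e + N {b,e} a + N
      {b,e} c + N {a,e} b + N {a,e} c + N {b,c} e + N {d,e} a + N {d,e} b + N {a,d} e + N
      {b,e} d + N {a,e} d + N {b,d} e + N {d,e} c + N {c,e} d + N {c,d} e) + 15"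
    using ne ne[THEN not_sym]
    by (simp add: Xe t[of b c] t[of b d] t[of b e] t[of c d] t[of c e] t[of d e])
  moreover have "even S \<Longrightarrow> S = 2 * M + 15 \<Longrightarrow> False" for S M :: int by presburger
  ultimately show False by blast
qed

text \<open>An edge and three successive apexes span a K_5.\<close>

lemma cone_cone_cone_mod2_planar_empty:
  assumes E: "\<forall>e\<in>E. card e = 2" and cone: "cone_class (cone_class (cone_class mod2_planar)) E"
  shows "E = {}"
proof (rule ccontr)
  assume "E \<noteq> {}"
  then obtain e where "e \<in> E" by blast
  then have "card e = 2" using E by blast
  then obtain a b where "e = {a, b}"  "a \<noteq> b"
    by (meson card_2_iff)
  with \<open>e \<in> E\<close> have ab: "{a, b} \<in> E" "a \<noteq> b" by auto
  obtain x where x: "x \<notin> \<Union>E" "cone_class (cone_class mod2_planar) (E \<union> (\<lambda>w. {x, w}) ` \<Union>E)"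
    using cone unfolding cone_class_def[where E = E] by blast
  define F where "F = E \<union> (\<lambda>w. {x, w}) ` \<Union>E"
  have F: "{a, b} \<in> F" "{x, a} \<in> F" "{x, b} \<in> F" using ab by (auto simp: F_def)
  obtain y where y: "y \<notin> \<Union>F" "cone_class mod2_planar (F \<union> (\<lambda>w. {y, w}) ` \<Union>F)"
    using x(2) unfolding F_def[symmetric] cone_class_def[where E = F] by blast
  define G where "G = F \<union> (\<lambda>w. {y, w}) ` \<Union>F"
  have G: "F \<subseteq> G" "{y, a} \<in> G" "{y, b} \<in> G" "{y, x} \<in> G" using F by (auto simp: G_def)
  obtain z where z: "z \<notin> \<Union>G" "mod2_planar (G \<union> (\<lambda>w. {z, w}) ` \<Union>G)"
    using y(2) unfolding G_def[symmetric] cone_class_def[where E = G] by blast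
  define H where "H = G \<union> (\<lambda>w. {z, w}) ` \<Union>G"
  have H: "G \<subseteq> H" "{z, a} \<in> H" "{z, b} \<in> H" "{z, x} \<in> H" "{z, y} \<in> H"
    using F G by (auto simp: H_def)
  have "a \<in> \<Union>E" "b \<in> \<Union>E" using ab(1) by blast+
  moreover have "{x, a, b} \<subseteq> \<Union>F" using F by blast
  moreover have "{y, x, a, b} \<subseteq> \<Union>G" using G by blast
  ultimately have "distinct [z, y, x, a, b]"
    using ab(2) x(1) y(1) z(1) by force
  moreover have "mod2_planar H" using z(2) by (simp add: H_def)
  moreover have "{{z,y},{z,x},{z,a},{z,b},{y,x},{y,a},{y,b},{x,a},{x,b},{a,b}} \<subseteq> H"
    using H G F by blast
  ultimately show False by (rule not_mod2_planar_K5)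
qed

text \<open>Undoing the cones one at a time by Mader's argument gives the constants 1, 2 and 4: the
  first because the triply coned class has no edges, the others by doubling.\<close>

lemma mod2_planar_edge_bound:
  assumes "finite V" "V \<noteq> {}" "\<forall>e\<in>E. e \<subseteq> V \<and> card e = 2" "mod2_planar E"
  shows "card E < 4 * card V"
proof -
  let ?P1 = "cone_class mod2_planar" and ?P2 = "cone_class (cone_class mod2_planar)"
  have closed: "minor_closed mod2_planar" "minor_closed ?P1" "minor_closed ?P2"
    by (intro minor_closed_cone_class minor_closed_mod2_planar)+
  have b2: "card E < 1 * card V"
    if V: "finite V" "V \<noteq> {}" and E: "\<forall>e\<in>E. e \<subseteq> V \<and> card e = 2" "?P2 E" for V :: "'a set" and E
  proof (rule minor_closed_edge_bound[OF closed(3) _ V E])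
    fix V :: "'a set" and E
    assume "finite V" "V \<noteq> {}" "\<forall>e\<in>E. e \<subseteq> V \<and> card e = 2" "cone_class ?P2 E"
    then show "2 * card E < 1 * card V"
      using cone_cone_cone_mod2_planar_empty[of E] by (auto simp: card_gt_0_iff)
  qed simp
  have b1: "card E < 2 * card V"
    if V: "finite V" "V \<noteq> {}" and E: "\<forall>e\<in>E. e \<subseteq> V \<and> card e = 2" "?P1 E" for V :: "'a set" and E
  proof (rule minor_closed_edge_bound[OF closed(2) _ V E])
    fix V :: "'a set" and E
    assume "finite V" "V \<noteq> {}" "\<forall>e\<in>E. e \<subseteq> V \<and> card e = 2" "?P2 E"
    then show "2 * card E < 2 * card V" using b2[of V E] by simp
  qed simp
  show ?thesis
  proof (rule minor_closed_edge_bound[OF closed(1) _ assms])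
    fix V :: "'a set" and E
    assume "finite V" "V \<noteq> {}" "\<forall>e\<in>E. e \<subseteq> V \<and> card e = 2" "?P1 E"
    then show "2 * card E < 4 * card V" using b1[of V E] by simp
  qed simp
qed

section \<open>Bipartite subgraphs and the passage from odd to even parities\<close>

text \<open>Vertices are added one at a time. Every edge from the new vertex to an old one is cut by
  one of the two positions of the new vertex, so one position cuts at least half of these
  edges.\<close>

lemma max_cut:
  assumes "finite V" "\<forall>e\<in>E. e \<subseteq> V \<and> card e = 2"
  obtains W where "card E \<le> 2 * card {e\<in>E. card (e \<inter> W) = 1}"
proof -
  have "\<exists>W\<subseteq>V. card E \<le> 2 * card {e\<in>E. card (e \<inter> W) = 1}"
    using assms
  proof (induction V arbitrary: E rule: finite_induct)
    case empty
    then have "E = {}" by fastforce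
    then show ?case by simp
  next
    case (insert x V)
    have finE: "finite E"
      using insert.prems insert.hyps(1) by (meson Pow_iff finite_Pow_iff finite_insert finite_subset subsetI)
    define E0 where "E0 = {e\<in>E. x \<notin> e}"
    have "\<forall>e\<in>E0. e \<subseteq> V \<and> card e = 2"
      using insert.prems unfolding E0_def by blast
    then obtain W where W: "W \<subseteq> V" "card E0 \<le> 2 * card {e\<in>E0. card (e \<inter> W) = 1}"
      using insert.IH[of E0] by blast
    let ?X = "{e\<in>E. x \<in> e}"
    let ?A = "{e\<in>?X. card (e \<inter> W) = 1}" and ?B = "{e\<in>?X. card (e \<inter> insert x W) = 1}"
    have xW: "x \<notin> W" using W(1) insert.hyps(2) by blast
    have "?X = ?A \<union> ?B"
    proof -
      have "card (e \<inter> W) = 1 \<or> card (e \<inter> insert x W) = 1" if e: "e \<in> E" "x \<in> e" for e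
      proof -
        obtain y where "e = {x, y}" "x \<noteq> y"
          using insert.prems e by (metis card_2_iff doubleton_eq_iff insert_iff singletonD)
        then show ?thesis using xW by (cases "y \<in> W") auto
      qed
      then show ?thesis by blast
    qed
    then have "card ?X = card (?A \<union> ?B)" by (rule arg_cong)
    then have X: "card ?X \<le> card ?A + card ?B" using card_Un_le[of ?A ?B] by (rule ord_eq_le_trans)
    have cE: "card E = card E0 + card ?X"
    proof -
      have "E = E0 \<union> ?X" "E0 \<inter> ?X = {}" by (auto simp: E0_def)
      then show ?thesis using finE by (metis card_Un_disjoint finite_Un)
    qed
    have cut: "card {e\<in>E0. card (e \<inter> W) = 1} + card {e\<in>?X. card (e \<inter> U) = 1}
        \<le> card {e\<in>E. card (e \<inter> U) = 1}" if U: "U = W \<or> U = insert x W" for U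
    proof -
      have "e \<inter> U = e \<inter> W" if "e \<in> E0" for e
        using U that by (auto simp: E0_def)
      then have sub: "{e\<in>E0. card (e \<inter> W) = 1} \<union> {e\<in>?X. card (e \<inter> U) = 1}
          \<subseteq> {e\<in>E. card (e \<inter> U) = 1}" (is "?L \<union> ?R \<subseteq> _")
        by (auto simp: E0_def)
      have "card ?L + card ?R = card (?L \<union> ?R)"
        using finE by (intro card_Un_disjoint[symmetric]) (auto simp: E0_def)
      also have "\<dots> \<le> card {e\<in>E. card (e \<inter> U) = 1}"
        using finE sub by (intro card_mono) auto
      finally show ?thesis .
    qed
    have "card E \<le> 2 * card {e\<in>E. card (e \<inter> W) = 1} \<or> card E \<le> 2 * card {e\<in>E. card (e \<inter> insert x W) = 1}"
      using cut[OF disjI1[OF refl]] cut[OF disjI2[OF refl]] X cE W(2) by linarith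
    then show ?case using W(1) by blast
  qed
  then show ?thesis using that by blast
qed

text \<open>After passing to a bipartite subgraph, reversing \<open>s\<close> inside one colour class changes
  the parity of every pair of disjoint edges.\<close>
lemma odd_crossing_edge_bound:
  assumes V: "finite V" "V \<noteq> {}" and E: "\<forall>e\<in>E. e \<subseteq> V \<and> card e = 2"
    and s: "\<And>p q. p \<noteq> q \<Longrightarrow> odd (s p q + s q p)"
    and odd: "\<And>A B. \<lbrakk>A \<in> E; B \<in> E; A \<inter> B = {}\<rbrakk> \<Longrightarrow> odd (crossing_parity s N A B)"
  shows "card E < 8 * card V"
proof -
  obtain W where W: "card E \<le> 2 * card {e\<in>E. card (e \<inter> W) = 1}"
    using max_cut[OF V(1) E] by blast
  define F where "F = {e\<in>E. card (e \<inter> W) = 1}"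
  \<comment> \<open>Two disjoint edges between \<open>W\<close> and its complement have exactly one
    pair of ends inside \<open>W\<close>, so exactly one term changes, by 1. The sum
    \<open>r p q + r q p\<close> differs from the old one by 0 or 2 and stays odd.\<close>
  define r where "r p q = (if p \<in> W \<and> q \<in> W then s p q + 1 else s p q)" for p q
  have pair: "\<exists>w u. A = {w, u} \<and> w \<in> W \<and> u \<notin> W" if A: "A \<in> F" for A
  proof -
    have "A \<in> E" "card (A \<inter> W) = 1" using A by (auto simp: F_def)
    moreover obtain p q where pq: "A = {p, q}" "p \<noteq> q"
      using E \<open>A \<in> E\<close> by (meson card_2_iff)
    ultimately show ?thesis
      by (cases "p \<in> W"; cases "q \<in> W") auto
  qed
  have "even (crossing_parity r N A B)" if AB: "A \<in> F" "B \<in> F" "A \<inter> B = {}" for A B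
  proof -
    obtain w u where A: "A = {w, u}" "w \<in> W" "u \<notin> W" using pair[OF AB(1)] by blast
    obtain x y where B: "B = {x, y}" "x \<in> W" "y \<notin> W" using pair[OF AB(2)] by blast
    have ne: "w \<noteq> u" "x \<noteq> y" using A B by auto
    have "crossing_parity r N A B = crossing_parity s N A B + 1"
      using A(2,3) B(2,3) unfolding A(1) B(1) crossing_parity_pairs[OF ne] by (simp add: r_def)
    then show ?thesis using odd[of A B] AB by (simp add: F_def)
  qed
  moreover have "odd (r p q + r q p)" if "p \<noteq> q" for p q
    using s[OF that] by (simp add: r_def)
  moreover have "\<forall>e\<in>F. card e = 2" using E by (simp add: F_def)
  ultimately have "mod2_planar F"
    unfolding mod2_planar_def by (intro conjI exI[of _ r] exI[of _ N]) blast+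
  moreover have "\<forall>e\<in>F. e \<subseteq> V \<and> card e = 2" using E by (simp add: F_def)
  ultimately have "card F < 4 * card V"
    using mod2_planar_edge_bound[OF V] by blast
  then show ?thesis using W by (simp add: F_def)
qed

section \<open>Intersection numbers of paths\<close>

text \<open>Rotation by pi about 0 preserves turning. For a merely continuous path this is
  transferred from a polynomial approximation that is closer to the path than the path is to
  0.\<close>

lemma winding_number_uminus_path:
  assumes "path g" "0 \<notin> path_image g"
  shows "winding_number (\<lambda>t. - g t) 0 = winding_number g 0"
proof -
  obtain d where d: "d > 0" "\<And>t. t \<in> {0..1} \<Longrightarrow> d \<le> norm (g t)"
  proof -
    have "0 < setdist {0} (path_image g)"
      using assms by (simp add: setdist_gt_0_compact_closed compact_path_image compact_imp_closed)
    moreover have "setdist {0} (path_image g) \<le> norm (g t)" if "t \<in> {0..1}" for t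
      using setdist_le_dist[of 0 "{0}" "g t" "path_image g"] that by (simp add: path_image_def)
    ultimately show ?thesis using that by blast
  qed
  obtain p where p: "polynomial_function p" "pathstart p = pathstart g" "pathfinish p = pathfinish g"
    "\<And>t. t \<in> {0..1} \<Longrightarrow> norm (p t - g t) < d"
    using path_approx_polynomial_function[OF assms(1) d(1)] by metis
  have vp: "valid_path p" using p(1) by (rule valid_path_polynomial_function)
  have 0: "0 \<notin> path_image p"
  proof
    assume "0 \<in> path_image p"
    then obtain t where "t \<in> {0..1}" "p t = 0" by (auto simp: path_image_def)
    then show False using p(4)[of t] d(2)[of t] by simp
  qed
  have "winding_number p 0 = winding_number g 0"
    using p d by (intro winding_number_nearby_paths_eq assms valid_path_imp_path vp) force+
  moreover have "winding_number (uminus \<circ> p) 0 = winding_number (\<lambda>t. - g t) 0"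
  proof (rule winding_number_nearby_paths_eq)
    show "path (\<lambda>t. - g t)" "path (uminus \<circ> p)"
      using assms(1) valid_path_imp_path[OF vp] unfolding path_def o_def
      by (auto intro: continuous_on_minus)
    show "pathstart (uminus \<circ> p) = pathstart (\<lambda>t. - g t)" "pathfinish (uminus \<circ> p) = pathfinish (\<lambda>t. - g t)"
      using p(2,3) by (auto simp: pathstart_def pathfinish_def)
    show "norm ((uminus \<circ> p) t - - g t) < norm (- g t - 0)" if "t \<in> {0..1}" for t
      using p(4)[of t] d(2)[of t] that by (simp add: norm_minus_commute)
  qed
  ultimately show ?thesis using winding_number_negatepath[OF vp 0] by simp
qed

text \<open>The winding number about 0 of \<open>(s, t) \<mapsto> g s - d t\<close> along the boundary of the unit
  square, i.e. the algebraic number of crossings of \<open>g\<close> and \<open>d\<close>.\<close>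
definition intersection_number :: "(real \<Rightarrow> complex) \<Rightarrow> (real \<Rightarrow> complex) \<Rightarrow> real" where
  "intersection_number g d =
     Re (winding_number g (pathstart d)) - Re (winding_number g (pathfinish d))
     + Re (winding_number d (pathfinish g)) - Re (winding_number d (pathstart g))"

text \<open>The map g s - d t has no zero on the unit square, so its images of the two boundary
  routes from (0, 0) to (1, 1) are homotopic in the punctured plane. The real parts of their winding
  numbers differ by the intersection number.\<close>

lemma intersection_number_disjoint:
  assumes g: "path g" and d: "path d" and disj: "path_image g \<inter> path_image d = {}"
  shows "intersection_number g d = 0"
proof -
  define F where "F = (\<lambda>z::real \<times> real. g (fst z) - d (snd z))"
  let ?S = "{0..1::real} \<times> {0..1::real}"
  let ?b = "linepath (0, 0) (1, 0::real)" and ?r = "linepath (1, 0) (1::real, 1::real)"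
  let ?l = "linepath (0::real, 0) (0, 1::real)" and ?t = "linepath (0::real, 1::real) (1, 1)"
  have "continuous_on ?S F"
    unfolding F_def using g d by (auto simp: path_def intro!: continuous_intros continuous_on_compose2[of "{0..1}" g] continuous_on_compose2[of "{0..1}" d])
  moreover have "F ` ?S \<subseteq> - {0}"
    using disj by (auto simp: F_def path_image_def)
  moreover have "homotopic_paths ?S (?b +++ ?r) (?l +++ ?t)"
  proof -
    have conv: "convex ?S" by (intro convex_Times) auto
    have seg: "closed_segment x y \<subseteq> ?S" if "x \<in> ?S" "y \<in> ?S" for x y
      using conv that by (simp add: closed_segment_subset)
    have "path_image (?b +++ ?r) \<subseteq> ?S" "path_image (?l +++ ?t) \<subseteq> ?S"
      by (intro order_trans[OF path_image_join_subset] Un_least; simp add: seg)+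
    then show ?thesis
      using conv
      by (intro convex_imp_simply_connected[THEN simply_connected_eq_homotopic_paths[THEN iffD1], THEN conjunct2, rule_format])
         auto
  qed
  ultimately have "homotopic_paths (- {0}) (F \<circ> (?b +++ ?r)) (F \<circ> (?l +++ ?t))"
    by (intro homotopic_paths_continuous_image[where h = F and S = ?S]) auto
  then have "winding_number (F \<circ> (?b +++ ?r)) 0 = winding_number (F \<circ> (?l +++ ?t)) 0"
    by (rule winding_number_homotopic_paths)
  moreover have "F \<circ> (?b +++ ?r) = (\<lambda>s. g s - pathstart d) +++ (\<lambda>t. pathfinish g - d t)"
    by (rule ext) (auto simp: joinpaths_def F_def linepath_def pathstart_def pathfinish_def)
  moreover have "F \<circ> (?l +++ ?t) = (\<lambda>t. pathstart g - d t) +++ (\<lambda>s. g s - pathfinish d)"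
    by (rule ext) (auto simp: joinpaths_def F_def linepath_def pathstart_def pathfinish_def)
  moreover have gp: "path (\<lambda>s. g s - a)" "path (\<lambda>t. a - d t)" for a
    using g d unfolding path_def by (auto intro!: continuous_intros)
  moreover have nz: "0 \<notin> path_image (\<lambda>s. g s - pathstart d)" "0 \<notin> path_image (\<lambda>s. g s - pathfinish d)"
    "0 \<notin> path_image (\<lambda>t. pathfinish g - d t)" "0 \<notin> path_image (\<lambda>t. pathstart g - d t)"
    using disj pathstart_in_path_image[of g] pathfinish_in_path_image[of g]
      pathstart_in_path_image[of d] pathfinish_in_path_image[of d]
    unfolding path_image_def by (auto 4 3)
  ultimately have "winding_number (\<lambda>s. g s - pathstart d) 0 + winding_number (\<lambda>t. pathfinish g - d t) 0
      = winding_number (\<lambda>t. pathstart g - d t) 0 + winding_number (\<lambda>s. g s - pathfinish d) 0"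
    by (simp add: winding_number_join pathstart_def pathfinish_def)
  moreover have "winding_number (\<lambda>s. g s - a) 0 = winding_number g a" for a
    by (rule winding_number_offset[symmetric])
  moreover have "winding_number (\<lambda>t. a - d t) 0 = winding_number d a" if "a \<notin> path_image d" for a
  proof -
    have "winding_number (\<lambda>t. - (d t - a)) 0 = winding_number (\<lambda>t. d t - a) 0"
    proof (rule winding_number_uminus_path)
      show "path (\<lambda>t. d t - a)" using d unfolding path_def by (auto intro!: continuous_intros)
      show "0 \<notin> path_image (\<lambda>t. d t - a)" using that by (auto simp: path_image_def)
    qed
    then show ?thesis by (simp add: winding_number_offset[of d a])
  qed
  moreover have "pathfinish g \<notin> path_image d" "pathstart g \<notin> path_image d"
    using disj by auto
  ultimately show ?thesis
    unfolding intersection_number_def by (simp add: complex_eq_iff)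
qed

lemma intersection_number_closed:
  assumes "pathfinish g = pathstart g"
  shows "intersection_number g d =
    Re (winding_number g (pathstart d)) - Re (winding_number g (pathfinish d))"
  using assms by (simp add: intersection_number_def)

lemma intersection_number_reversepath:
  assumes "path g" "pathstart d \<notin> path_image g" "pathfinish d \<notin> path_image g"
  shows "intersection_number (reversepath g) d = - intersection_number g d"
  using assms by (simp add: intersection_number_def winding_number_reversepath)

lemma intersection_number_commute: "intersection_number g d = - intersection_number d g"
  by (simp add: intersection_number_def)

lemma intersection_number_join:
  assumes "path g" "path h" "pathfinish g = pathstart h"
    and "pathstart d \<notin> path_image g \<union> path_image h" "pathfinish d \<notin> path_image g \<union> path_image h"
  shows "intersection_number (g +++ h) d = intersection_number g d + intersection_number h d"
  using assms by (simp add: intersection_number_def winding_number_join)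

text \<open>The winding number of \<open>g\<close> about the cut point \<open>d t\<close> occurs
  once with each sign and cancels.\<close>

lemma intersection_number_split_right:
  assumes d: "path d" and t: "t \<in> {0..1}"
    and ends: "pathstart g \<notin> path_image d" "pathfinish g \<notin> path_image d"
  shows "intersection_number g d = intersection_number g (subpath 0 t d) + intersection_number g (subpath t 1 d)"
  using winding_number_subpath_combine[OF d ends(1), of 0 t 1] winding_number_subpath_combine[OF d ends(2), of 0 t 1] t
  by (simp add: intersection_number_def algebra_simps) (simp add: pathstart_def pathfinish_def complex_eq_iff)

section \<open>Lenses\<close>

definition lens :: "(real \<Rightarrow> complex) \<Rightarrow> (real \<Rightarrow> complex) \<Rightarrow> bool" where
  "lens e f \<longleftrightarrow> arc e \<and> arc f \<and> {pathstart e, pathfinish e} = {pathstart f, pathfinish f} \<and>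
     path_image e \<inter> path_image f = {pathstart e, pathfinish e}"

text \<open>Parallel edges may be drawn in the same or in opposite directions, so \<open>f\<close>
  is reversed if necessary to close \<open>e\<close> up to a Jordan curve.\<close>

lemma lens_loop:
  assumes "lens e f"
  obtains c where "c = f \<or> c = reversepath f" "pathstart c = pathfinish e" "pathfinish c = pathstart e"
    "simple_path (e +++ c)" "path_image (e +++ c) = path_image e \<union> path_image f"
proof -
  define c where "c = (if pathstart f = pathfinish e then f else reversepath f)"
  have "arc e" using assms unfolding lens_def by blast
  then have "pathstart e \<noteq> pathfinish e" by (simp add: arc_distinct_ends eq_commute)
  consider "pathstart f = pathstart e" "pathfinish f = pathfinish e"
    | "pathstart f = pathfinish e" "pathfinish f = pathstart e"
    using assms unfolding lens_def doubleton_eq_iff by metis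
  then have ends: "pathstart c = pathfinish e" "pathfinish c = pathstart e"
    using \<open>pathstart e \<noteq> pathfinish e\<close> by (cases; simp add: c_def)+
  have c: "path_image c = path_image f" "arc c"
    using assms unfolding lens_def c_def by (simp_all add: arc_reversepath)
  show ?thesis
  proof (rule that)
    show "c = f \<or> c = reversepath f" by (simp add: c_def)
    show "pathstart c = pathfinish e" by (rule ends)
    show "pathfinish c = pathstart e" by (rule ends)
    show "simple_path (e +++ c)"
    proof (rule simple_path_join_loop)
      show "arc e" "arc c" by fact+
      have "path_image e \<inter> path_image f = {pathstart e, pathfinish e}"
        using assms unfolding lens_def by blast
      then show "path_image e \<inter> path_image c \<subseteq> {pathstart e, pathstart c}"
        unfolding c(1) ends(1) by simp
    qed (use ends in simp_all)
    show "path_image (e +++ c) = path_image e \<union> path_image f"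
      using ends(1) c(1) by (simp add: path_image_join)
  qed
qed

lemma lens_inside_outside:
  assumes "lens e f"
  shows "connected (inside (path_image e \<union> path_image f))"
    "frontier (inside (path_image e \<union> path_image f)) = path_image e \<union> path_image f"
proof -
  obtain c where "c = f \<or> c = reversepath f" and c: "pathstart c = pathfinish e" "pathfinish c = pathstart e"
    "simple_path (e +++ c)" "path_image (e +++ c) = path_image e \<union> path_image f"
    by (rule lens_loop[OF assms])
  have "pathfinish (e +++ c) = pathstart (e +++ c)" using c(2) by simp
  from Jordan_inside_outside[OF c(3) this]
  show "connected (inside (path_image e \<union> path_image f))"
    "frontier (inside (path_image e \<union> path_image f)) = path_image e \<union> path_image f"
    unfolding c(4) by auto
qed

lemma lens_closure_inside:
  assumes "lens e f"
  shows "closure (inside (path_image e \<union> path_image f)) \<inter> outside (path_image e \<union> path_image f) = {}"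
    "path_image e \<subseteq> closure (inside (path_image e \<union> path_image f))"
proof -
  have cl: "closure (inside (path_image e \<union> path_image f)) =
      inside (path_image e \<union> path_image f) \<union> (path_image e \<union> path_image f)"
    using lens_inside_outside(2)[OF assms] by (simp add: closure_Un_frontier)
  show "closure (inside (path_image e \<union> path_image f)) \<inter> outside (path_image e \<union> path_image f) = {}"
    unfolding cl using inside_Int_outside[of "path_image e \<union> path_image f"]
      outside_no_overlap[of "path_image e \<union> path_image f"] by blast
  show "path_image e \<subseteq> closure (inside (path_image e \<union> path_image f))"
    unfolding cl by blast
qed

text \<open>The boundary loop of the lens has winding number 1 or -1 inside and 0 outside, so its
  intersection number with \<open>d\<close> records only whether \<open>d\<close> changes sides. The
  sign in \<open>c\<close> is the direction in which the loop runs through \<open>f\<close>.\<close>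

lemma lens_intersection_number:
  assumes ef: "lens e f" and d: "path d"
    and ends: "pathstart d \<notin> path_image e \<union> path_image f" "pathfinish d \<notin> path_image e \<union> path_image f"
  obtains c where "c = intersection_number f d \<or> c = - intersection_number f d"
    "\<bar>intersection_number e d + c\<bar> =
       (if pathstart d \<in> inside (path_image e \<union> path_image f) \<longleftrightarrow>
           pathfinish d \<in> inside (path_image e \<union> path_image f) then 0 else 1)"
proof -
  obtain c where c: "c = f \<or> c = reversepath f" "pathstart c = pathfinish e" "pathfinish c = pathstart e"
    "simple_path (e +++ c)" "path_image (e +++ c) = path_image e \<union> path_image f"
    by (rule lens_loop[OF ef])
  let ?p = "e +++ c" and ?I = "inside (path_image e \<union> path_image f)"
  have loop: "pathfinish ?p = pathstart ?p" using c by simp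
  have pf: "path f" "path e" using ef by (auto simp: lens_def arc_imp_path)
  then have pc: "path c" "path_image c = path_image f" using c(1) by auto
  obtain s :: real where s: "\<bar>s\<bar> = 1" "\<And>z. z \<in> ?I \<Longrightarrow> Re (winding_number ?p z) = s"
  proof (rule simple_closed_path_winding_number_inside[OF c(4)])
    assume "\<And>z. z \<in> inside (path_image ?p) \<Longrightarrow> winding_number ?p z = 1"
    then show thesis using that[of 1] unfolding c(5) by simp
  next
    assume "\<And>z. z \<in> inside (path_image ?p) \<Longrightarrow> winding_number ?p z = -1"
    then show thesis using that[of "-1"] unfolding c(5) by simp
  qed
  have wn: "Re (winding_number ?p z) = (if z \<in> ?I then s else 0)" if "z \<notin> path_image e \<union> path_image f" for z
  proof (cases "z \<in> ?I")
    case False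
    then have "z \<in> outside (path_image ?p)" unfolding c(5) using that inside_Un_outside by blast
    then show ?thesis
      using winding_number_zero_in_outside[OF simple_path_imp_path[OF c(4)] loop] False by simp
  qed (simp add: s)
  have "intersection_number e d + intersection_number c d = intersection_number ?p d"
    using ends c pc pf by (intro intersection_number_join[symmetric]) auto
  also have "\<dots> = (if pathstart d \<in> ?I then s else 0) - (if pathfinish d \<in> ?I then s else 0)"
    using intersection_number_closed[OF loop, of d] wn[OF ends(1)] wn[OF ends(2)] by simp
  finally have eq: "intersection_number e d + intersection_number c d
     = (if pathstart d \<in> ?I then s else 0) - (if pathfinish d \<in> ?I then s else 0)" .
  have "intersection_number c d = intersection_number f d \<or> intersection_number c d = - intersection_number f d"
    using c(1) intersection_number_reversepath[OF pf(1), of d] ends by auto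
  moreover have "\<bar>intersection_number e d + intersection_number c d\<bar> =
       (if pathstart d \<in> ?I \<longleftrightarrow> pathfinish d \<in> ?I then 0 else 1)"
    unfolding eq using s(1) by simp
  ultimately show ?thesis by (rule that)
qed

text \<open>Both halves of an arc through the lens must leave it, so one of them crosses
  exactly one side and the other one exactly the other side.\<close>
lemma crossing_lens_intersection_number:
  assumes ef: "lens e f" and k: "arc k"
    and out: "pathstart k \<in> outside (path_image e \<union> path_image f)"
      "pathfinish k \<in> outside (path_image e \<union> path_image f)"
    and ends: "pathstart e \<notin> path_image k" "pathfinish e \<notin> path_image k"
    and enters: "path_image k \<inter> inside (path_image e \<union> path_image f) \<noteq> {}"
    and once: "\<And>p q. \<lbrakk>p \<in> path_image e \<inter> path_image k; q \<in> path_image e \<inter> path_image k\<rbrakk> \<Longrightarrow> p = q"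
      "\<And>p q. \<lbrakk>p \<in> path_image f \<inter> path_image k; q \<in> path_image f \<inter> path_image k\<rbrakk> \<Longrightarrow> p = q"
  shows "\<bar>intersection_number e k\<bar> = 1"
proof -
  let ?J = "path_image e \<union> path_image f"
  obtain z where "z \<in> path_image k" "z \<in> inside ?J"
    using enters by blast
  then obtain t where t: "t \<in> {0..1}" "k t \<in> inside ?J"
    unfolding path_image_def[of k] by blast
  define k1 where "k1 = subpath 0 t k"
  define k2 where "k2 = subpath t 1 k"
  have pk: "path k" using k by (rule arc_imp_path)
  have p12: "path k1" "path k2"
    using t(1) pk by (auto simp: k1_def k2_def intro: path_subpath)
  have im: "path_image k1 = k ` {0..t}" "path_image k2 = k ` {t..1}"
    using t(1) by (auto simp: k1_def k2_def path_image_subpath)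
  have sub: "path_image k1 \<subseteq> path_image k" "path_image k2 \<subseteq> path_image k"
    unfolding im using t(1) by (auto simp: path_image_def)
  have inj: "inj_on k {0..1}" using k by (simp add: arc_def)
  have meet: "path_image k1 \<inter> path_image k2 \<subseteq> {k t}"
  proof
    fix p assume "p \<in> path_image k1 \<inter> path_image k2"
    then obtain r s where rs: "r \<in> {0..t}" "s \<in> {t..1}" "p = k r" "p = k s" by (auto simp: im)
    then have "r = s" using inj_onD[OF inj, of r s] t(1) by auto
    then show "p \<in> {k t}" using rs by (metis atLeastAtMost_iff order_antisym singletonI)
  qed
  have se: "pathstart k1 = pathstart k" "pathfinish k1 = k t" "pathstart k2 = k t" "pathfinish k2 = pathfinish k"
    by (auto simp: k1_def k2_def pathstart_def pathfinish_def subpath_def)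
  have nJ: "k t \<notin> ?J" "pathstart k \<notin> ?J" "pathfinish k \<notin> ?J"
    using t(2) out inside_no_overlap outside_no_overlap by blast+
  have not_in: "pathstart k \<notin> inside ?J" "pathfinish k \<notin> inside ?J"
    using out inside_Int_outside by blast+
  have hits: "path_image g \<inter> ?J \<noteq> {}"
    if "path g" "path_image g \<inter> inside ?J \<noteq> {}" "path_image g \<inter> outside ?J \<noteq> {}" for g
  proof -
    have "path_image g \<inter> frontier (inside ?J) \<noteq> {}"
      using that inside_Int_outside by (intro connected_Int_frontier connected_path_image) blast+
    then show ?thesis using lens_inside_outside(2)[OF ef] by simp
  qed
  have h1: "path_image k1 \<inter> ?J \<noteq> {}"
    using pathstart_in_path_image[of k1] pathfinish_in_path_image[of k1] out(1) t(2) se p12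
    by (intro hits) auto
  have h2: "path_image k2 \<inter> ?J \<noteq> {}"
    using pathstart_in_path_image[of k2] pathfinish_in_path_image[of k2] out(2) t(2) se p12
    by (intro hits) auto
  obtain p where p: "p \<in> path_image k1" "p \<in> ?J" using h1 by blast
  obtain q where q: "q \<in> path_image k2" "q \<in> ?J" using h2 by blast
  have pq: "p \<notin> path_image k2" "q \<notin> path_image k1" using p q meet nJ(1) by blast+
  then have "p \<noteq> q" using p by blast
  have split: "intersection_number e k = intersection_number e k1 + intersection_number e k2"
    unfolding k1_def k2_def by (rule intersection_number_split_right[OF pk t(1) ends])
  have pe: "path e" "path f" using ef by (auto simp: lens_def arc_imp_path)
  \<comment> \<open>Each side meets \<open>k\<close> at most once, so \<open>p\<close> and
    \<open>q\<close> lie on different sides. Then each half of \<open>k\<close> avoids one side, and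
    its entire intersection number with the loop comes from the other.\<close>
  consider "p \<in> path_image e" "q \<in> path_image f" | "p \<in> path_image f" "q \<in> path_image e"
    using p q \<open>p \<noteq> q\<close> once sub by blast
  then show ?thesis
  proof cases
    case 1
    then have "path_image f \<inter> path_image k1 = {}" "path_image e \<inter> path_image k2 = {}"
      using once p q pq sub by blast+
    then have 0: "intersection_number f k1 = 0" "intersection_number e k2 = 0"
      using intersection_number_disjoint pe p12 by auto
    obtain c where "c = intersection_number f k1 \<or> c = - intersection_number f k1"
      "\<bar>intersection_number e k1 + c\<bar> = 1"
      using lens_intersection_number[OF ef p12(1)] se nJ t(2) not_in by (smt (verit))
    then show ?thesis using split 0 by auto
  next
    case 2
    then have "path_image e \<inter> path_image k1 = {}" "path_image f \<inter> path_image k2 = {}"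
      using once p q pq sub by blast+
    then have 0: "intersection_number e k1 = 0" "intersection_number f k2 = 0"
      using intersection_number_disjoint pe p12 by auto
    obtain c where "c = intersection_number f k2 \<or> c = - intersection_number f k2"
      "\<bar>intersection_number e k2 + c\<bar> = 1"
      using lens_intersection_number[OF ef p12(2)] se nJ t(2) not_in by (smt (verit))
    then show ?thesis using split 0 by auto
  qed
qed

text \<open>The inside of the first lens is connected and misses the boundary of the second, so it
  lies entirely on the side of the second that contains the common point \<open>x\<close>.\<close>

lemma lens_inside_subset:
  assumes ef: "lens e f" and gh: "lens g h"
    and x: "x \<in> inside (path_image e \<union> path_image f)" "x \<in> inside (path_image g \<union> path_image h)"
    and disj: "(path_image g \<union> path_image h) \<inter> inside (path_image e \<union> path_image f) = {}"
  shows "inside (path_image e \<union> path_image f) \<subseteq> inside (path_image g \<union> path_image h)"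
proof (rule ccontr)
  let ?I = "inside (path_image e \<union> path_image f)" and ?K = "path_image g \<union> path_image h"
  assume "\<not> ?I \<subseteq> inside ?K"
  then have "?I \<inter> frontier (inside ?K) \<noteq> {}"
    using x by (intro connected_Int_frontier lens_inside_outside(1)[OF ef]) blast+
  then show False using disj lens_inside_outside(2)[OF gh] by blast
qed

text \<open>Otherwise the inside of the first lens lies in the second one. Taking closures, the ends
  of \<open>e\<close> would lie in the closed second lens, although \<open>pathstart e\<close> is
  outside of it.\<close>

lemma lens_enters_lens:
  assumes ef: "lens e f" and gh: "lens g h"
    and x: "x \<in> inside (path_image e \<union> path_image f)" "x \<in> inside (path_image g \<union> path_image h)"
    and out: "pathstart e \<in> outside (path_image g \<union> path_image h)"
  shows "(path_image g \<union> path_image h) \<inter> inside (path_image e \<union> path_image f) \<noteq> {}"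
proof
  let ?I = "inside (path_image e \<union> path_image f)" and ?K = "path_image g \<union> path_image h"
  assume disj: "?K \<inter> ?I = {}"
  have "?I \<subseteq> inside ?K" by (rule lens_inside_subset[OF ef gh x disj])
  then have "closure ?I \<subseteq> closure (inside ?K)" by (rule closure_mono)
  moreover have "pathstart e \<in> closure ?I"
    using lens_closure_inside(2)[OF ef] by auto
  ultimately show False
    using lens_closure_inside(1)[OF gh] out by blast
qed

text \<open>At least one of \<open>g\<close> and \<open>h\<close> enters the lens of
  \<open>e\<close> and \<open>f\<close>, and that side has intersection number 1 or -1 with
  \<open>e\<close>. As \<open>e\<close> starts and ends outside the lens of \<open>g\<close> and
  \<open>h\<close>, its intersection numbers with these two agree up to sign, so it does not matter
  which one enters.\<close>

lemma lenses_intersection_number: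
  assumes ef: "lens e f" and gh: "lens g h"
    and x: "x \<in> inside (path_image e \<union> path_image f)" "x \<in> inside (path_image g \<union> path_image h)"
    and out_e: "pathstart e \<in> outside (path_image g \<union> path_image h)"
      "pathfinish e \<in> outside (path_image g \<union> path_image h)"
    and out_g: "pathstart g \<in> outside (path_image e \<union> path_image f)"
      "pathfinish g \<in> outside (path_image e \<union> path_image f)"
    and once: "\<And>j k p q. \<lbrakk>j \<in> {e, f}; k \<in> {g, h}; p \<in> path_image j \<inter> path_image k;
        q \<in> path_image j \<inter> path_image k\<rbrakk> \<Longrightarrow> p = q"
  shows "\<bar>intersection_number e g\<bar> = 1"
proof -
  have arcs: "arc e" "arc g" "arc h" using ef gh by (auto simp: lens_def)
  have nin: "pathstart e \<notin> path_image g \<union> path_image h" "pathfinish e \<notin> path_image g \<union> path_image h"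
    using out_e outside_no_overlap by blast+
  have nJ: "pathstart e \<notin> inside (path_image g \<union> path_image h)" "pathfinish e \<notin> inside (path_image g \<union> path_image h)"
    using out_e inside_Int_outside by blast+
  have one: "\<bar>intersection_number e k\<bar> = 1"
    if "k \<in> {g, h}" "path_image k \<inter> inside (path_image e \<union> path_image f) \<noteq> {}" for k
  proof (rule crossing_lens_intersection_number[OF ef])
    have "{pathstart k, pathfinish k} = {pathstart g, pathfinish g}"
      using gh that(1) by (auto simp: lens_def)
    then have "pathstart k \<in> {pathstart g, pathfinish g}" "pathfinish k \<in> {pathstart g, pathfinish g}"
      by blast+
    then show "pathstart k \<in> outside (path_image e \<union> path_image f)"
      "pathfinish k \<in> outside (path_image e \<union> path_image f)"
      using out_g by auto
    show "arc k" "pathstart e \<notin> path_image k" "pathfinish e \<notin> path_image k"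
      using that(1) arcs nin by auto
    show "path_image k \<inter> inside (path_image e \<union> path_image f) \<noteq> {}" by (rule that(2))
  qed (use once that(1) in blast)+
  have "\<bar>intersection_number e g\<bar> = \<bar>intersection_number e h\<bar>"
  proof -
    obtain c where "c = intersection_number h e \<or> c = - intersection_number h e"
      "\<bar>intersection_number g e + c\<bar> = 0"
      using lens_intersection_number[OF gh arc_imp_path[OF arcs(1)] nin] nJ by (smt (verit))
    then show ?thesis
      using intersection_number_commute[of e g] intersection_number_commute[of e h] by auto
  qed
  moreover obtain k where "k \<in> {g, h}" "path_image k \<inter> inside (path_image e \<union> path_image f) \<noteq> {}"
    using lens_enters_lens[OF ef gh x out_e(1)] by auto
  ultimately show ?thesis using one[of k] by auto
qed

section \<open>Intersection numbers modulo 2\<close>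

lemma Im_Ln_minus: "z \<noteq> 0 \<Longrightarrow> Im (Ln (- z)) = Im (Ln z) + pi \<or> Im (Ln (- z)) = Im (Ln z) - pi"
  by (simp add: Ln_minus)

text \<open>The number under the floor is an integer: both terms measure the turn of \<open>g\<close>
  around \<open>z\<close>, up to full turns.\<close>
definition excess_turns :: "(real \<Rightarrow> complex) \<Rightarrow> complex \<Rightarrow> int" where
  "excess_turns g z = \<lfloor>Re (winding_number g z) -
     (Im (Ln (pathfinish g - z)) - Im (Ln (pathstart g - z))) / (2 * pi)\<rfloor>"

lemma winding_number_excess_turns:
  assumes "path g" "z \<notin> path_image g"
  shows "Re (winding_number g z) =
    (Im (Ln (pathfinish g - z)) - Im (Ln (pathstart g - z))) / (2 * pi) + excess_turns g z"
proof -
  have nz: "pathfinish g - z \<noteq> 0" "pathstart g - z \<noteq> 0"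
    using assms(2) pathfinish_in_path_image[of g] pathstart_in_path_image[of g] by auto
  have "exp (Ln (pathfinish g - z)) = exp (2 * pi * \<i> * winding_number g z + Ln (pathstart g - z))"
    using winding_number_exp_2pi[OF assms] nz by (simp add: exp_add)
  then obtain n :: int where
    "Ln (pathfinish g - z) = 2 * pi * \<i> * winding_number g z + Ln (pathstart g - z) + of_int (2 * n) * pi * \<i>"
    by (auto simp: exp_eq)
  from arg_cong[OF this, of Im]
  have "Im (Ln (pathfinish g - z)) = 2 * pi * Re (winding_number g z) + Im (Ln (pathstart g - z)) + 2 * n * pi"
    by simp
  then have "Re (winding_number g z) -
     (Im (Ln (pathfinish g - z)) - Im (Ln (pathstart g - z))) / (2 * pi) = of_int (- n)"
    by (simp add: field_simps)
  then show ?thesis unfolding excess_turns_def by (simp del: of_int_minus)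
qed

text \<open>Principal arguments of opposite vectors differ by exactly pi; this bit records which of
  them is larger.\<close>

definition turn_sign :: "complex \<Rightarrow> complex \<Rightarrow> int" where
  "turn_sign p q = (if Im (Ln (p - q)) > Im (Ln (q - p)) then 1 else 0)"

lemma turn_sign:
  assumes "p \<noteq> q"
  shows "Im (Ln (p - q)) / (2 * pi) - Im (Ln (q - p)) / (2 * pi) = of_int (turn_sign p q) - 1/2"
proof -
  have "Im (Ln (q - p)) = Im (Ln (p - q)) + pi \<or> Im (Ln (q - p)) = Im (Ln (p - q)) - pi"
    using Im_Ln_minus[of "p - q"] assms by simp
  then show ?thesis
  proof
    assume "Im (Ln (q - p)) = Im (Ln (p - q)) + pi"
    then show ?thesis using pi_gt_zero by (simp add: turn_sign_def field_simps)
  next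
    assume *: "Im (Ln (q - p)) = Im (Ln (p - q)) - pi"
    then have "turn_sign p q = 1" using pi_gt_zero by (simp add: turn_sign_def)
    then show ?thesis unfolding * by (simp add: field_simps)
  qed
qed

lemma odd_turn_sign_add: "p \<noteq> q \<Longrightarrow> odd (turn_sign p q + turn_sign q p)"
  using Im_Ln_minus[of "p - q"] pi_gt_zero by (cases "Im (Ln (q - p)) > Im (Ln (p - q))") (auto simp: turn_sign_def)

text \<open>Once the winding numbers are written as argument differences plus full turns, each end
  of \<open>g\<close> and end of \<open>d\<close> contribute the arguments of two opposite vectors,
  that is, a turn sign minus 1/2. The halves cancel in the alternating sum, and signs are irrelevant
  modulo 2.\<close>

lemma odd_crossing_of_intersection_number:
  assumes g: "path g" and d: "path d"
    and ends: "pathstart g \<notin> path_image d" "pathfinish g \<notin> path_image d"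
      "pathstart d \<notin> path_image g" "pathfinish d \<notin> path_image g"
    and one: "\<bar>intersection_number g d\<bar> = 1"
  shows "odd (turn_sign (pathstart g) (pathstart d) + turn_sign (pathstart g) (pathfinish d)
    + turn_sign (pathfinish g) (pathstart d) + turn_sign (pathfinish g) (pathfinish d)
    + excess_turns g (pathstart d) + excess_turns g (pathfinish d)
    + excess_turns d (pathstart g) + excess_turns d (pathfinish g))"
proof -
  let ?a = "pathstart g" and ?v = "pathfinish g" and ?b = "pathstart d" and ?w = "pathfinish d"
  have ne: "?v \<noteq> ?b" "?a \<noteq> ?b" "?a \<noteq> ?w" "?v \<noteq> ?w"
    using ends pathstart_in_path_image[of d] pathfinish_in_path_image[of d] by metis+
  define m where "m = turn_sign ?v ?b - turn_sign ?a ?b + turn_sign ?a ?w - turn_sign ?v ?w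
     + excess_turns g ?b - excess_turns g ?w + excess_turns d ?v - excess_turns d ?a"
  have "intersection_number g d = of_int m"
    using winding_number_excess_turns[OF g ends(3)] winding_number_excess_turns[OF g ends(4)]
      winding_number_excess_turns[OF d ends(1)] winding_number_excess_turns[OF d ends(2)]
      turn_sign[OF ne(1)] turn_sign[OF ne(2)] turn_sign[OF ne(3)] turn_sign[OF ne(4)]
    unfolding intersection_number_def m_def diff_divide_distrib by simp
  then have "\<bar>m\<bar> = 1" using one by linarith
  then have "odd m" by (auto simp: abs_if split: if_splits)
  moreover have "turn_sign ?a ?b + turn_sign ?a ?w + turn_sign ?v ?b + turn_sign ?v ?w
    + excess_turns g ?b + excess_turns g ?w + excess_turns d ?a + excess_turns d ?v
    = m + 2 * (turn_sign ?a ?b + turn_sign ?v ?w + excess_turns g ?w + excess_turns d ?a)"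
    unfolding m_def by simp
  moreover have "odd i \<Longrightarrow> j = i + 2 * k \<Longrightarrow> odd j" for i j k :: int by simp
  ultimately show ?thesis by blast
qed

section \<open>Separated drawings\<close>

lemma path_image_edge_interior:
  "path_image g = edge_interior g \<union> {pathstart g, pathfinish g}"
proof -
  have "{0..1} = {0<..<1::real} \<union> {0, 1}" by auto
  then show ?thesis
    unfolding path_image_def edge_interior_def pathstart_def pathfinish_def
    by (metis image_Un image_empty image_insert)
qed

lemma edge_interior_ends:
  assumes "arc g"
  shows "edge_interior g \<inter> {pathstart g, pathfinish g} = {}"
proof -
  have "g t \<noteq> g 0" "g t \<noteq> g 1" if "t \<in> {0<..<1}" for t
    using assms that unfolding arc_def by (auto dest: inj_onD)
  then show ?thesis
    unfolding edge_interior_def pathstart_def pathfinish_def by fastforce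
qed

lemma edge_interior_nonempty: "edge_interior g \<noteq> {}"
proof -
  have "g (1/2) \<in> edge_interior g" unfolding edge_interior_def by (intro imageI) simp
  then show ?thesis by blast
qed

definition edge_ends :: "('e \<Rightarrow> real \<Rightarrow> complex) \<Rightarrow> 'e \<Rightarrow> complex set" where
  "edge_ends \<gamma> e = {pathstart (\<gamma> e), pathfinish (\<gamma> e)}"

definition edge_pair :: "('e \<Rightarrow> real \<Rightarrow> complex) \<Rightarrow> 'e \<Rightarrow> 'e \<Rightarrow> complex set" where
  "edge_pair \<gamma> e f = path_image (\<gamma> e) \<union> path_image (\<gamma> f)"

definition thin_lens ::
  "complex set \<Rightarrow> 'e set \<Rightarrow> ('e \<Rightarrow> real \<Rightarrow> complex) \<Rightarrow> complex \<Rightarrow> 'e \<Rightarrow> 'e \<Rightarrow> bool" where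
  "thin_lens V E \<gamma> x e f \<longleftrightarrow> e \<in> E \<and> f \<in> E \<and> e \<noteq> f \<and> edge_ends \<gamma> e = edge_ends \<gamma> f \<and>
     V \<inter> inside (edge_pair \<gamma> e f) = {x}"

locale separated_drawing =
  fixes V :: "complex set" and E :: "'e set" and \<gamma> :: "'e \<Rightarrow> real \<Rightarrow> complex"
  assumes drawing: "topological_multigraph V E \<gamma>"
    and single: "single_crossing E \<gamma>"
    and sep: "separated V E \<gamma>"
begin

lemma finite_V: "finite V" and finite_E: "finite E"
  using drawing by (auto simp: topological_multigraph_def)

lemma arc_edge: "e \<in> E \<Longrightarrow> arc (\<gamma> e)"
  using drawing by (simp add: topological_multigraph_def)

lemma edge_ends_in_V: "e \<in> E \<Longrightarrow> edge_ends \<gamma> e \<subseteq> V"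
  using drawing by (simp add: topological_multigraph_def edge_ends_def)

lemma edge_Int_V: "e \<in> E \<Longrightarrow> path_image (\<gamma> e) \<inter> V = edge_ends \<gamma> e"
  using drawing by (simp add: topological_multigraph_def edge_ends_def)

lemma card_edge_ends: "e \<in> E \<Longrightarrow> card (edge_ends \<gamma> e) = 2"
  using arc_distinct_ends[OF arc_edge, of e] by (simp add: edge_ends_def card_insert_if eq_commute)

lemma interior_Int_V: "e \<in> E \<Longrightarrow> edge_interior (\<gamma> e) \<inter> V = {}"
  using edge_Int_V[of e] edge_interior_ends[OF arc_edge, of e] path_image_edge_interior[of "\<gamma> e"]
  unfolding edge_ends_def by blast

lemma parallel_lens:
  assumes "e \<in> E" "f \<in> E" "e \<noteq> f" "edge_ends \<gamma> e = edge_ends \<gamma> f"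
  shows "lens (\<gamma> e) (\<gamma> f)"
proof -
  have "edge_interior (\<gamma> e) \<inter> edge_interior (\<gamma> f) = {}"
    using sep assms unfolding separated_def parallel_edges_def edge_ends_def by blast
  moreover have "edge_interior (\<gamma> e) \<inter> edge_ends \<gamma> f = {}" "edge_interior (\<gamma> f) \<inter> edge_ends \<gamma> e = {}"
    using interior_Int_V assms edge_ends_in_V by blast+
  ultimately have "path_image (\<gamma> e) \<inter> path_image (\<gamma> f) = edge_ends \<gamma> e"
    using assms(4) unfolding path_image_edge_interior edge_ends_def by blast
  then show ?thesis
    using assms arc_edge unfolding lens_def edge_ends_def by blast
qed

lemma lens_has_vertex:
  assumes "e \<in> E" "f \<in> E" "e \<noteq> f" "edge_ends \<gamma> e = edge_ends \<gamma> f"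
  shows "V \<inter> inside (edge_pair \<gamma> e f) \<noteq> {}"
  using sep assms unfolding separated_def parallel_edges_def edge_ends_def edge_pair_def by blast

text \<open>Edges without a common end meet only in interior points, where the single-crossing
  property applies.\<close>

lemma cross_once:
  assumes "e \<in> E" "f \<in> E" "edge_ends \<gamma> e \<inter> edge_ends \<gamma> f = {}"
    and "p \<in> path_image (\<gamma> e) \<inter> path_image (\<gamma> f)" "q \<in> path_image (\<gamma> e) \<inter> path_image (\<gamma> f)"
  shows "p = q"
proof -
  have "e \<noteq> f" using assms(1,3) card_edge_ends[of e] by auto
  moreover have "path_image (\<gamma> e) \<inter> path_image (\<gamma> f) \<subseteq> edge_interior (\<gamma> e) \<inter> edge_interior (\<gamma> f)"
    using interior_Int_V[OF assms(1)] interior_Int_V[OF assms(2)] edge_ends_in_V[OF assms(1)]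
      edge_ends_in_V[OF assms(2)] assms(3)
    unfolding path_image_edge_interior edge_ends_def by blast
  ultimately show ?thesis
    using single assms unfolding single_crossing_def by blast
qed

lemma thin_lens_not_end: "thin_lens V E \<gamma> x e f \<Longrightarrow> x \<in> V - edge_ends \<gamma> e"
  using inside_no_overlap[of "edge_pair \<gamma> e f"] path_image_edge_interior[of "\<gamma> e"]
  unfolding thin_lens_def edge_ends_def edge_pair_def by blast

text \<open>A third parallel edge entering the lens would split it into two disjoint lenses.
  Separation puts a vertex into each of them, but only \<open>x\<close> is available.\<close>

lemma thin_lens_avoids:
  assumes ef: "thin_lens V E \<gamma> x e f" and g: "g \<in> E" "edge_ends \<gamma> g = edge_ends \<gamma> e"
  shows "path_image (\<gamma> g) \<inter> inside (edge_pair \<gamma> e f) = {}"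
proof (cases "g = e \<or> g = f")
  case True
  then show ?thesis
    using inside_no_overlap[of "edge_pair \<gamma> e f"] unfolding edge_pair_def by blast
next
  case False
  define a b where "a = pathstart (\<gamma> e)" and "b = pathfinish (\<gamma> e)"
  have ends: "edge_ends \<gamma> e = {a, b}" by (simp add: edge_ends_def a_def b_def)
  \<comment> \<open>All three edges are directed from \<open>a\<close> to \<open>b\<close>, so that
    they form a theta curve.\<close>
  define c where "c k = (if pathstart (\<gamma> k) = a then \<gamma> k else reversepath (\<gamma> k))" for k
  have E: "e \<in> E" "f \<in> E" "e \<noteq> f" "edge_ends \<gamma> f = {a, b}" "edge_ends \<gamma> g = {a, b}"
    using ef g ends by (auto simp: thin_lens_def)
  have ab: "a \<noteq> b" using card_edge_ends[OF E(1)] ends by auto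
  have c: "simple_path (c k)" "pathstart (c k) = a" "pathfinish (c k) = b" "path_image (c k) = path_image (\<gamma> k)"
    if k: "k \<in> E" "edge_ends \<gamma> k = {a, b}" for k
  proof -
    consider "pathstart (\<gamma> k) = a" "pathfinish (\<gamma> k) = b" | "pathstart (\<gamma> k) = b" "pathfinish (\<gamma> k) = a"
      using k(2) unfolding edge_ends_def doubleton_eq_iff by blast
    then show "simple_path (c k)" "pathstart (c k) = a" "pathfinish (c k) = b"
      "path_image (c k) = path_image (\<gamma> k)"
      using arc_imp_simple_path[OF arc_edge[OF k(1)]] ab
      by (cases; simp add: c_def simple_path_reversepath)+
  qed
  have meet: "path_image (\<gamma> k) \<inter> path_image (\<gamma> l) = {a, b}"
    if "k \<in> E" "l \<in> E" "k \<noteq> l" "edge_ends \<gamma> k = {a, b}" "edge_ends \<gamma> l = {a, b}" for k l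
    using parallel_lens[of k l] that unfolding lens_def edge_ends_def by simp
  show ?thesis
  proof (rule ccontr)
    assume enters: "path_image (\<gamma> g) \<inter> inside (edge_pair \<gamma> e f) \<noteq> {}"
    note ce = c[OF E(1) ends] and cf = c[OF E(2,4)] and cg = c[OF g(1) E(5)]
    have ne: "path_image (c g) \<inter> inside (path_image (c e) \<union> path_image (c f)) \<noteq> {}"
      using enters unfolding ce(4) cf(4) cg(4) edge_pair_def .
    have meets: "path_image (c e) \<inter> path_image (c f) = {a, b}" "path_image (c e) \<inter> path_image (c g) = {a, b}"
      "path_image (c f) \<inter> path_image (c g) = {a, b}"
      unfolding ce(4) cf(4) cg(4) using meet E g(1) ends False by auto
    obtain "inside (path_image (c e) \<union> path_image (c g)) \<inter> inside (path_image (c f) \<union> path_image (c g)) = {}"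
      "inside (path_image (c e) \<union> path_image (c g)) \<union> inside (path_image (c f) \<union> path_image (c g))
         \<union> (path_image (c g) - {a, b}) = inside (path_image (c e) \<union> path_image (c f))"
      by (rule split_inside_simple_closed_curve[OF ce(1,2,3) cf(1,2,3) cg(1,2,3) ab meets ne])
    then have split: "inside (edge_pair \<gamma> e g) \<inter> inside (edge_pair \<gamma> f g) = {}"
      "inside (edge_pair \<gamma> e g) \<union> inside (edge_pair \<gamma> f g) \<subseteq> inside (edge_pair \<gamma> e f)"
      unfolding ce(4) cf(4) cg(4) edge_pair_def by auto
    have "e \<noteq> g" "f \<noteq> g" using False by auto
    then have "V \<inter> inside (edge_pair \<gamma> e g) \<noteq> {}" "V \<inter> inside (edge_pair \<gamma> f g) \<noteq> {}"
      using lens_has_vertex[OF E(1) g(1)] lens_has_vertex[OF E(2) g(1)] E(4,5) ends by simp_all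
    then obtain p q where p: "p \<in> V" "p \<in> inside (edge_pair \<gamma> e g)"
      and q: "q \<in> V" "q \<in> inside (edge_pair \<gamma> f g)" by blast
    have "v = x" if "v \<in> V" "v \<in> inside (edge_pair \<gamma> e f)" for v
    proof -
      have "v \<in> V \<inter> inside (edge_pair \<gamma> e f)" using that by simp
      then show ?thesis using ef unfolding thin_lens_def by simp
    qed
    then have "p = x" "q = x" using p q split(2) by auto
    then show False using p(2) q(2) split(1) by blast
  qed
qed

text \<open>Neither boundary enters the other lens and both lenses contain \<open>x\<close>, so
  their insides coincide, and hence their frontiers. A side of one that is not a side of the other
  would be covered by two arcs that it meets only in its ends.\<close>

lemma thin_lens_unique:
  assumes ef: "thin_lens V E \<gamma> x e f" and gh: "thin_lens V E \<gamma> x g h"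
    and ends: "edge_ends \<gamma> e = edge_ends \<gamma> g"
  shows "{e, f} = {g, h}"
proof (rule ccontr)
  assume "{e, f} \<noteq> {g, h}"
  then obtain k where k: "k \<in> {g, h}" "k \<notin> {e, f}"
    using gh unfolding thin_lens_def by blast
  have E: "e \<in> E" "f \<in> E" "g \<in> E" "h \<in> E" "edge_ends \<gamma> f = edge_ends \<gamma> e" "edge_ends \<gamma> h = edge_ends \<gamma> e"
    using ef gh ends by (auto simp: thin_lens_def)
  have lens: "lens (\<gamma> e) (\<gamma> f)" "lens (\<gamma> g) (\<gamma> h)"
    using ef gh parallel_lens by (auto simp: thin_lens_def)
  have x: "x \<in> inside (path_image (\<gamma> e) \<union> path_image (\<gamma> f))" "x \<in> inside (path_image (\<gamma> g) \<union> path_image (\<gamma> h))"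
    using ef gh unfolding thin_lens_def edge_pair_def by blast+
  have "inside (path_image (\<gamma> e) \<union> path_image (\<gamma> f)) \<subseteq> inside (path_image (\<gamma> g) \<union> path_image (\<gamma> h))"
    using thin_lens_avoids[OF ef] E ends unfolding edge_pair_def
    by (intro lens_inside_subset[OF lens x]) (simp add: Int_Un_distrib2)
  moreover have "inside (path_image (\<gamma> g) \<union> path_image (\<gamma> h)) \<subseteq> inside (path_image (\<gamma> e) \<union> path_image (\<gamma> f))"
    using thin_lens_avoids[OF gh] E ends unfolding edge_pair_def
    by (intro lens_inside_subset[OF lens(2,1) x(2,1)]) (simp add: Int_Un_distrib2)
  ultimately have "path_image (\<gamma> e) \<union> path_image (\<gamma> f) = path_image (\<gamma> g) \<union> path_image (\<gamma> h)"
    using lens_inside_outside(2)[OF lens(1)] lens_inside_outside(2)[OF lens(2)] by (metis subset_antisym)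
  then have "path_image (\<gamma> k) \<subseteq> path_image (\<gamma> e) \<union> path_image (\<gamma> f)" using k(1) by auto
  moreover have kE: "k \<in> E" "edge_ends \<gamma> k = edge_ends \<gamma> e" using k(1) E ends by auto
  then have "path_image (\<gamma> e) \<inter> path_image (\<gamma> k) = edge_ends \<gamma> e" "path_image (\<gamma> f) \<inter> path_image (\<gamma> k) = edge_ends \<gamma> e"
    using parallel_lens[of e k] parallel_lens[of f k] k(2) E unfolding lens_def edge_ends_def by auto
  ultimately have "path_image (\<gamma> k) \<subseteq> edge_ends \<gamma> k" using kE by blast
  then show False
    using edge_interior_ends[OF arc_edge[OF kE(1)]] edge_interior_nonempty[of "\<gamma> k"]
      path_image_edge_interior[of "\<gamma> k"] unfolding edge_ends_def by blast
qed

text \<open>As \<open>x\<close> is the only vertex inside either of two thin lenses with disjoint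
  ends, the ends of each lie outside the other. Chosen sides of the two lenses thus have
  intersection number 1 or -1, so the end pairs form a graph on \<open>V - {x}\<close> all of whose
  disjoint edges have odd parity.\<close>

lemma thin_lenses_bound:
  assumes "x \<in> V" "V \<noteq> {x}"
  shows "card {edge_ends \<gamma> e | e f. thin_lens V E \<gamma> x e f} < 8 * card (V - {x})"
proof -
  define H where "H = {edge_ends \<gamma> e | e f. thin_lens V E \<gamma> x e f}"
  have "\<exists>e f. \<forall>A\<in>H. thin_lens V E \<gamma> x (e A) (f A) \<and> edge_ends \<gamma> (e A) = A"
  proof -
    have "\<forall>A\<in>H. \<exists>e f. thin_lens V E \<gamma> x e f \<and> edge_ends \<gamma> e = A" by (auto simp: H_def)
    then show ?thesis by metis
  qed
  then obtain e f where ef: "\<And>A. A \<in> H \<Longrightarrow> thin_lens V E \<gamma> x (e A) (f A)"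
    and ends: "\<And>A. A \<in> H \<Longrightarrow> edge_ends \<gamma> (e A) = A" by metis
  \<comment> \<open>The end pair \<open>A\<close> is drawn as the chosen side \<open>e A\<close>;
    the other side enters only through the topology of the lens.\<close>
  define N where "N A = excess_turns (\<gamma> (e A))" for A
  have "card H < 8 * card (V - {x})"
  proof (rule odd_crossing_edge_bound[where s = turn_sign and N = N])
    show "finite (V - {x})" "V - {x} \<noteq> {}" using finite_V assms by auto
    show "\<forall>A\<in>H. A \<subseteq> V - {x} \<and> card A = 2"
    proof
      fix A assume A: "A \<in> H"
      then have "e A \<in> E" using ef unfolding thin_lens_def by blast
      then show "A \<subseteq> V - {x} \<and> card A = 2"
        using edge_ends_in_V[of "e A"] card_edge_ends[of "e A"] thin_lens_not_end[OF ef[OF A]] ends[OF A]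
          by auto
    qed
    show "odd (turn_sign p q + turn_sign q p)" if "p \<noteq> q" for p q
      using that by (rule odd_turn_sign_add)
    fix A B assume AB: "A \<in> H" "B \<in> H" "A \<inter> B = {}"
    let ?e = "\<gamma> (e A)" and ?f = "\<gamma> (f A)" and ?g = "\<gamma> (e B)" and ?h = "\<gamma> (f B)"
    have E: "e C \<in> E" "f C \<in> E" "e C \<noteq> f C" "edge_ends \<gamma> (e C) = C" "edge_ends \<gamma> (f C) = C"
      "x \<in> inside (path_image (\<gamma> (e C)) \<union> path_image (\<gamma> (f C)))"
      "V \<inter> inside (path_image (\<gamma> (e C)) \<union> path_image (\<gamma> (f C))) = {x}" "x \<notin> C" if "C \<in> H" for C
      using ef[OF that] ends[OF that] thin_lens_not_end[OF ef[OF that]]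
      unfolding thin_lens_def edge_pair_def by auto
    have out: "z \<in> outside (path_image (\<gamma> (e D)) \<union> path_image (\<gamma> (f D)))"
      if "C \<in> H" "D \<in> H" "C \<inter> D = {}" "z \<in> C" for C D z
    proof -
      have "z \<in> V" "z \<noteq> x" using E(1,4,8)[OF that(1)] edge_ends_in_V that(4) by blast+
      moreover have "z \<notin> path_image (\<gamma> (e D)) \<union> path_image (\<gamma> (f D))"
        using edge_Int_V E(1,2,4,5)[OF that(2)] that(3,4) \<open>z \<in> V\<close> by blast
      ultimately show ?thesis
        using E(7)[OF that(2)] inside_Un_outside[of "path_image (\<gamma> (e D)) \<union> path_image (\<gamma> (f D))"] by blast
    qed
    have AB': "B \<inter> A = {}" using AB(3) by blast
    have A: "A = {pathstart ?e, pathfinish ?e}" and B: "B = {pathstart ?g, pathfinish ?g}"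
      using ends AB unfolding edge_ends_def by auto
    have one: "\<bar>intersection_number ?e ?g\<bar> = 1"
    proof (rule lenses_intersection_number)
      show "lens ?e ?f" "lens ?g ?h" using E AB by (auto intro!: parallel_lens)
      show "x \<in> inside (path_image ?e \<union> path_image ?f)" "x \<in> inside (path_image ?g \<union> path_image ?h)"
        using E(6) AB by blast+
      show "pathstart ?e \<in> outside (path_image ?g \<union> path_image ?h)"
        "pathfinish ?e \<in> outside (path_image ?g \<union> path_image ?h)"
        by (rule out[OF AB]; subst A; simp)+
      show "pathstart ?g \<in> outside (path_image ?e \<union> path_image ?f)"
        "pathfinish ?g \<in> outside (path_image ?e \<union> path_image ?f)"
        by (rule out[OF AB(2,1) AB']; subst B; simp)+
      fix j k p q assume jk: "j \<in> {?e, ?f}" "k \<in> {?g, ?h}"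
        and pq: "p \<in> path_image j \<inter> path_image k" "q \<in> path_image j \<inter> path_image k"
      from jk obtain j' k' where jk': "j = \<gamma> j'" "k = \<gamma> k'" "j' \<in> {e A, f A}" "k' \<in> {e B, f B}" by blast
      then have "j' \<in> E" "k' \<in> E" "edge_ends \<gamma> j' \<inter> edge_ends \<gamma> k' = {}"
        using E(1,2,4,5) AB by auto
      then show "p = q" using cross_once pq jk'(1,2) by blast
    qed
    have off: "pathstart ?e \<notin> path_image ?g" "pathfinish ?e \<notin> path_image ?g"
      "pathstart ?g \<notin> path_image ?e" "pathfinish ?g \<notin> path_image ?e"
      using out[OF AB, of "pathstart ?e"] out[OF AB, of "pathfinish ?e"]
        out[OF AB(2,1) AB', of "pathstart ?g"] out[OF AB(2,1) AB', of "pathfinish ?g"] A B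
        outside_no_overlap[of "path_image ?g \<union> path_image ?h"] outside_no_overlap[of "path_image ?e \<union> path_image ?f"]
      by blast+
    have paths: "path ?e" "path ?g" using E(1) AB arc_edge arc_imp_path by blast+
    have ne: "pathstart ?e \<noteq> pathfinish ?e" "pathstart ?g \<noteq> pathfinish ?g"
      using arc_distinct_ends[OF arc_edge] E(1) AB by metis+
    have NA: "N {pathstart ?e, pathfinish ?e} = excess_turns ?e"
      and NB: "N {pathstart ?g, pathfinish ?g} = excess_turns ?g"
      using A B by (simp_all add: N_def)
    have "crossing_parity turn_sign N A B = crossing_parity turn_sign N {pathstart ?e, pathfinish ?e} {pathstart ?g, pathfinish ?g}"
      using A B by simp
    then show "odd (crossing_parity turn_sign N A B)"
      using odd_crossing_of_intersection_number[OF paths off one]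
      unfolding crossing_parity_pairs[OF ne] NA NB by simp
  qed
  then show ?thesis by (simp add: H_def)
qed

end

text \<open>Removing the vertex \<open>x\<close> empties only the lenses around \<open>x\<close> alone, and for every pair of
  ends there is at most one of these.\<close>
lemma (in separated_drawing) delete_vertex:
  assumes x: "x \<in> V" "V \<noteq> {x}"
  obtains F where "F \<subseteq> E" "separated_drawing (V - {x}) F \<gamma>"
    "card E \<le> card F + card {e\<in>E. x \<in> edge_ends \<gamma> e} + 8 * card (V - {x})"
proof -
  define H where "H = {edge_ends \<gamma> e | e f. thin_lens V E \<gamma> x e f}"
  have "\<forall>A\<in>H. \<exists>e. (\<exists>f. thin_lens V E \<gamma> x e f) \<and> edge_ends \<gamma> e = A" by (auto simp: H_def)
  then obtain r where r: "\<And>A. A \<in> H \<Longrightarrow> \<exists>f. thin_lens V E \<gamma> x (r A) f" "\<And>A. A \<in> H \<Longrightarrow> edge_ends \<gamma> (r A) = A"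
    by metis
  let ?D = "{e\<in>E. x \<in> edge_ends \<gamma> e}"
  define F where "F = E - ?D - r ` H"
  have FE: "F \<subseteq> E" by (auto simp: F_def)
  have "H \<subseteq> edge_ends \<gamma> ` E" by (auto simp: H_def thin_lens_def)
  then have finH: "finite H" using finite_E finite_surj by blast
  have "topological_multigraph (V - {x}) F \<gamma>"
  proof -
    have "path_image (\<gamma> e) \<inter> (V - {x}) = edge_ends \<gamma> e" "edge_ends \<gamma> e \<subseteq> V - {x}" if "e \<in> F" for e
    proof -
      have e: "e \<in> E" "x \<notin> edge_ends \<gamma> e" using that by (auto simp: F_def)
      then show "path_image (\<gamma> e) \<inter> (V - {x}) = edge_ends \<gamma> e" "edge_ends \<gamma> e \<subseteq> V - {x}"
        using edge_Int_V[OF e(1)] edge_ends_in_V[OF e(1)] by blast+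
    qed
    then have F: "pathstart (\<gamma> e) \<in> V - {x}" "pathfinish (\<gamma> e) \<in> V - {x}"
      "path_image (\<gamma> e) \<inter> (V - {x}) = {pathstart (\<gamma> e), pathfinish (\<gamma> e)}" if "e \<in> F" for e
      using that unfolding edge_ends_def by simp_all
    show ?thesis
      unfolding topological_multigraph_def
    proof (intro conjI ballI impI)
      show "finite (V - {x})" "finite F" using finite_V finite_subset[OF FE finite_E] by auto
      show "arc (\<gamma> e)" if "e \<in> F" for e using arc_edge FE that by blast
      fix e e' p assume "e \<in> F" "e' \<in> F" "e \<noteq> e'" "p \<in> edge_interior (\<gamma> e) \<inter> edge_interior (\<gamma> e')"
      moreover have "\<forall>e\<in>E. \<forall>e'\<in>E. e \<noteq> e' \<longrightarrow>
          (\<forall>p \<in> edge_interior (\<gamma> e) \<inter> edge_interior (\<gamma> e'). proper_crossing (\<gamma> e) (\<gamma> e') p)"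
        using drawing unfolding topological_multigraph_def by (elim conjE)
      ultimately show "proper_crossing (\<gamma> e) (\<gamma> e') p" using FE by blast
    qed (rule F; assumption)+
  qed
  moreover have "single_crossing F \<gamma>"
    using single FE unfolding single_crossing_def by blast
  moreover have "separated (V - {x}) F \<gamma>"
    unfolding separated_def
  proof (intro ballI impI conjI)
    fix e f assume F: "e \<in> F" "f \<in> F" and par: "e \<noteq> f \<and> parallel_edges \<gamma> e f"
    then have E: "e \<in> E" "f \<in> E" "e \<noteq> f" "edge_ends \<gamma> e = edge_ends \<gamma> f"
      using FE by (auto simp: parallel_edges_def edge_ends_def)
    show "edge_interior (\<gamma> e) \<inter> edge_interior (\<gamma> f) = {}"
      using sep E par unfolding separated_def by blast
    show "\<exists>v\<in>V - {x}. v \<in> inside (path_image (\<gamma> e) \<union> path_image (\<gamma> f))"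
    proof (rule ccontr)
      assume "\<not> (\<exists>v\<in>V - {x}. v \<in> inside (path_image (\<gamma> e) \<union> path_image (\<gamma> f)))"
      then have "V \<inter> inside (edge_pair \<gamma> e f) = {x}"
        using lens_has_vertex[OF E] unfolding edge_pair_def by blast
      then have thin: "thin_lens V E \<gamma> x e f" using E by (simp add: thin_lens_def)
      let ?A = "edge_ends \<gamma> e"
      have A: "?A \<in> H" using thin by (auto simp: H_def)
      then obtain g where "thin_lens V E \<gamma> x (r ?A) g" using r(1) by blast
      \<comment> \<open>By uniqueness, a thin lens left over would be the very one that has lost a
        side.\<close>
      then have "r ?A = e \<or> r ?A = f"
        using thin_lens_unique[OF thin, of "r ?A" g] r(2)[OF A] by auto
      moreover have "r ?A \<in> r ` H" using A by (rule imageI)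
      ultimately have "e \<in> r ` H \<or> f \<in> r ` H" by metis
      then show False using F unfolding F_def by blast
    qed
  qed
  ultimately have "separated_drawing (V - {x}) F \<gamma>" by (rule separated_drawing.intro)
  moreover have "card E \<le> card F + card ?D + 8 * card (V - {x})"
  proof -
    have "E \<subseteq> F \<union> (?D \<union> r ` H)" by (auto simp: F_def)
    then have "card E \<le> card (F \<union> (?D \<union> r ` H))"
      using finite_E finH FE finite_subset by (intro card_mono) auto
    also have "\<dots> \<le> card F + (card ?D + card (r ` H))"
      using card_Un_le[of F "?D \<union> r ` H"] card_Un_le[of ?D "r ` H"] by linarith
    also have "card (r ` H) \<le> card H" using finH by (rule card_image_le)
    finally show ?thesis using thin_lenses_bound[OF x] unfolding H_def by linarith
  qed
  ultimately show ?thesis using that FE by blast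
qed

section \<open>Solving the recursion\<close>

text \<open>By ln x <= x - 1 at x = (n - 1) / n, the natural logarithm grows by at least 1 / n from
  n - 1 to n, and the binary one by no less because ln 2 < 1. This growth pays for the error term 8
  n^2 of the recursion.\<close>

lemma log2_step:
  fixes n :: nat
  assumes "n \<ge> 3"
  shows "real n ^ 2 * 8 \<le> (real n - 2) * (64 * real n * (real n - 1) * (log 2 (real n) - log 2 (real n - 1)))"
proof -
  have n: "real n \<ge> 3" using assms by simp
  have "1 / real n \<le> ln (real n / (real n - 1))"
    using ln_le_minus_one[of "(real n - 1) / real n"] n by (simp add: ln_div field_simps)
  also have "\<dots> \<le> ln (real n / (real n - 1)) / ln 2"
  proof -
    have "ln (real n / (real n - 1)) \<ge> 0" using n by simp
    moreover have "0 < ln (2::real)" "ln (2::real) \<le> 1" using ln_2_less_1 by simp_all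
    ultimately show ?thesis
      using mult_right_mono[of "ln 2" 1 "ln (real n / (real n - 1))"] by (simp add: field_simps)
  qed
  also have "\<dots> = log 2 (real n) - log 2 (real n - 1)"
    using n by (simp add: log_def ln_div diff_divide_distrib)
  finally have "64 * real n * (real n - 1) * (1 / real n) \<le>
      64 * real n * (real n - 1) * (log 2 (real n) - log 2 (real n - 1))"
    using n by (intro mult_left_mono) auto
  then have "(real n - 2) * (64 * (real n - 1)) \<le>
      (real n - 2) * (64 * real n * (real n - 1) * (log 2 (real n) - log 2 (real n - 1)))"
    using n by (intro mult_left_mono) auto
  moreover have "real n ^ 2 * 8 \<le> (real n - 2) * (64 * (real n - 1))"
  proof -
    \<comment> \<open>This is the difference 56 n^2 - 192 n + 128 of the two sides, divided by n - 3
      with remainder.\<close>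
    have "0 \<le> (real n - 3) * (56 * real n - 24) + 56" using n by simp
    then show ?thesis by (simp add: power2_eq_square algebra_simps)
  qed
  ultimately show ?thesis by linarith
qed

text \<open>The factor n (n - 1) instead of n^2 fits the averaging: multiplication by n / (n - 2)
  takes (n - 1) (n - 2) exactly to n (n - 1), so only the logarithm has to absorb the loss from thin
  lenses.\<close>

lemma separated_drawing_edge_bound:
  assumes "separated_drawing V E \<gamma>" "card V = n" "n \<ge> 2"
  shows "real (card E) \<le> 64 * real n * (real n - 1) * log 2 (real n)"
  using assms(3,1,2)
proof (induction n arbitrary: V E rule: dec_induct)
  case base
  then interpret separated_drawing V E \<gamma> by blast
  \<comment> \<open>With two vertices every edge joins both, and a second edge would require a third
    vertex inside the lens.\<close>
  have all: "edge_ends \<gamma> e = V" if "e \<in> E" for e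
    using edge_ends_in_V[OF that] card_edge_ends[OF that] finite_V base(2) by (metis card_subset_eq)
  have "e = f" if "e \<in> E" "f \<in> E" for e f
  proof (rule ccontr)
    assume "e \<noteq> f"
    then have "V \<inter> inside (edge_pair \<gamma> e f) \<noteq> {}"
      using lens_has_vertex[OF that] all that by simp
    moreover have "V \<subseteq> path_image (\<gamma> e)"
      using edge_Int_V[OF that(1)] all[OF that(1)] by blast
    ultimately show False
      using inside_no_overlap[of "edge_pair \<gamma> e f"] unfolding edge_pair_def by blast
  qed
  then have "card E \<le> 1" using card_le_Suc0_iff_eq[OF finite_E] by simp
  then show ?case by simp
next
  case (step k)
  then interpret separated_drawing V E \<gamma> by blast
  define n where "n = Suc k"
  have n: "card V = n" "n \<ge> 3" "real k = real n - 1" using step.hyps step.prems(2) by (simp_all add: n_def)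
  \<comment> \<open>Some vertex has at most the average degree 2 |E| / n.\<close>
  have "\<exists>x\<in>V. n * card {e\<in>E. x \<in> edge_ends \<gamma> e} \<le> 2 * card E"
  proof (rule ccontr)
    assume "\<not> ?thesis"
    then have many: "2 * card E + 1 \<le> n * card {e\<in>E. v \<in> edge_ends \<gamma> e}" if "v \<in> V" for v
      using that by force
    have "card V * (2 * card E + 1) \<le> (\<Sum>v\<in>V. n * card {e\<in>E. v \<in> edge_ends \<gamma> e})"
      using sum_bounded_below[OF many] by simp
    also have "\<dots> = n * (2 * card E)"
      using sum_degrees[OF finite_V finite_E, of "edge_ends \<gamma>"] edge_ends_in_V card_edge_ends
      by (simp add: sum_distrib_left[symmetric])
    finally show False using n by simp
  qed
  then obtain x where x: "x \<in> V" "n * card {e\<in>E. x \<in> edge_ends \<gamma> e} \<le> 2 * card E" by blast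
  have "V \<noteq> {x}" using n by auto
  then obtain F where F: "F \<subseteq> E" "separated_drawing (V - {x}) F \<gamma>"
    "card E \<le> card F + card {e\<in>E. x \<in> edge_ends \<gamma> e} + 8 * card (V - {x})"
    using delete_vertex[OF x(1)] by blast
  define d where "d = card {e\<in>E. x \<in> edge_ends \<gamma> e}"
  have "card (V - {x}) = k" using step.prems(2) x(1) finite_V by simp
  with step.IH F(2) have IH: "real (card F) \<le> 64 * real k * (real k - 1) * log 2 (real k)" by blast
  have "real (card E) \<le> real (card F) + real d + 8 * real k"
    using F(3) \<open>card (V - {x}) = k\<close> unfolding d_def by linarith
  then have "real n * real (card E) \<le> real n * (64 * real k * (real k - 1) * log 2 (real k) + real d + 8 * real k)"
    using IH by (intro mult_left_mono) auto
  moreover have "real n * real d \<le> 2 * real (card E)"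
    using x(2) unfolding d_def by (metis of_nat_le_iff of_nat_mult of_nat_numeral)
  \<comment> \<open>The degree term, at most 2 |E| after multiplication by n, moves to the left and
    leaves the factor n - 2. The error 8 n (n - 1) is rounded up to 8 n^2.\<close>
  ultimately have "(real n - 2) * real (card E) \<le>
      (real n - 2) * (64 * real n * (real n - 1) * log 2 (real n - 1)) + 8 * real n ^ 2"
    using n(2,3) by (simp add: algebra_simps power2_eq_square)
  also have "\<dots> \<le> (real n - 2) * (64 * real n * (real n - 1) * log 2 (real n))"
    using log2_step[OF n(2)] by (simp add: algebra_simps)
  finally have "real (card E) \<le> 64 * real n * (real n - 1) * log 2 (real n)"
    by (rule mult_left_le_imp_le) (use n(2) in simp)
  then show ?case by (simp add: n_def)
qed

theorem theorem1:
  fixes V :: "complex set" and E :: "'e set" and \<gamma> :: "'e \<Rightarrow> real \<Rightarrow> complex" and n :: nat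
  assumes "topological_multigraph V E \<gamma>"
    and "single_crossing E \<gamma>"
    and "separated V E \<gamma>"
    and "card V = n"
  shows "real (card E) \<le> 64 * (real n)^2 * log 2 (real n)"
proof -
  interpret separated_drawing V E \<gamma> using assms(1-3) by (rule separated_drawing.intro)
  show ?thesis
  proof (cases "n \<ge> 2")
    case True
    have "64 * real n * (real n - 1) * log 2 (real n) \<le> 64 * real n * real n * log 2 (real n)"
      using True by (intro mult_right_mono mult_left_mono) auto
    then show ?thesis
      using separated_drawing_edge_bound[OF separated_drawing_axioms assms(4) True]
      by (simp add: power2_eq_square)
  next
    case False
    have "E = {}"
    proof (rule ccontr)
      assume "E \<noteq> {}"
      then obtain e where "e \<in> E" by blast
      then have "2 \<le> card V"
        using card_mono[OF finite_V edge_ends_in_V] card_edge_ends by metis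
      then show False using False assms(4) by simp
    qed
    \<comment> \<open>Both sides vanish: log 1 = 0, and for n = 0 the factor n^2 is 0.\<close>
    moreover have "n = 0 \<or> n = 1" using False by linarith
    ultimately show ?thesis by auto
  qed
qed

end
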